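(* Let $\lambda=(\lambda_n)$ be a frequency, $k>0$, and $(G,\beta)$ a $\lambda$-Dirichlet group. For $f\in H_1^\lambda(G)$ put $$R_{\max}^{\lambda,k}(f)(\omega):=\sup_{x>0}\Big|\sum_{\lambda_n<x}\widehat f(h_{\lambda_n})\Big(1-\frac{\lambda_n}{x}\Big)^k h_{\lambda_n}(\omega)\Big|,\qquad \omega\in G.$$ Then $R_{\max}^{\lambda,k}$ defines a bounded sublinear operator from $H_1^\lambda(G)$ to $L_{1,\infty}(G)$, and from $H_p^\lambda(G)$ to $L_p(G)$ whenever $1<p\le\infty$.
   Context: A frequency is a strictly increasing, unbounded sequence $\lambda=(\lambda_n)_{n\in\mathbb N}$ of non-negative real numbers. A Dirichlet group $(G,\beta)$ is a compact abelian group $G$ together with a continuous homomorphism $\beta:(\mathbb R,+)\to G$ with dense range. If for $x\in\mathbb R$ there is a (then unique) character of $G$, denoted $h_x\in\widehat G$, with $h_x(\beta(t))=e^{-ixt}$ for all $t\in\mathbb R$, one says that $h_x$ exists; $(G,\beta)$ is a $\lambda$-Dirichlet group if $h_{\lambda_n}$ exists for every $n$. Let $m$ be the normalized Haar measure on $G$, $L_p(G)=L_p(G,m)$ and $\widehat f(\gamma)=\int_G f\,\overline{\gamma}\,dm$ for $\gamma\in\widehat G$. For $1\le p\le\infty$, $H_p^\lambda(G)$ is the closed subspace of all $f\in L_p(G)$ such that $\widehat f(\gamma)\neq0$ implies $\gamma=h_{\lambda_n}$ for some $n$. $L_{1,\infty}(G)$ is the space of measurable $f:G\to\mathbb C$ for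 which $\|f\|_{1,\infty}:=\inf\{C>0: m(\{|f|>\alpha\})\le C/\alpha \text{ for all }\alpha>0\}$ is finite. A sublinear operator $T:X\to Y$ is bounded if there is a constant $C$ with $\|Tf\|_Y\le C\|f\|_X$ for all $f\in X$. *)

theory Defs
  imports "HOL-Probability.Probability"
begin

section \<open>Frequencies and Dirichlet groups\<close>

definition frequency :: "(nat \<Rightarrow> real) \<Rightarrow> bool" where
  "frequency lam \<longleftrightarrow> strict_mono lam \<and> (\<forall>n. 0 \<le> lam n) \<and> \<not> bdd_above (range lam)"

text \<open>Groups are written additively; compact spaces are Hausdorff, by the sort constraint.\<close>

definition dirichlet_group ::
    "(real \<Rightarrow> 'a::{topological_ab_group_add, t2_space}) \<Rightarrow> bool" where
  "dirichlet_group \<beta> \<longleftrightarrow>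
     compact (UNIV :: 'a set) \<and> continuous_on UNIV \<beta> \<and>
     (\<forall>s t. \<beta> (s + t) = \<beta> s + \<beta> t) \<and> closure (range \<beta>) = UNIV"

definition character :: "('a::topological_ab_group_add \<Rightarrow> complex) \<Rightarrow> bool" where
  "character \<gamma> \<longleftrightarrow>
     continuous_on UNIV \<gamma> \<and> (\<forall>v w. \<gamma> (v + w) = \<gamma> v * \<gamma> w) \<and> (\<forall>w. cmod (\<gamma> w) = 1)"

definition char_extends ::
    "(real \<Rightarrow> 'a::topological_ab_group_add) \<Rightarrow> real \<Rightarrow> ('a \<Rightarrow> complex) \<Rightarrow> bool" where
  "char_extends \<beta> x h \<longleftrightarrow>
     character h \<and> (\<forall>t. h (\<beta> t) = exp (- (\<i> * complex_of_real x * complex_of_real t)))"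

text \<open>The character \<open>h\<^sub>x\<close>; when it exists, it is unique because \<open>\<beta>\<close> has dense range.\<close>

definition hchar :: "(real \<Rightarrow> 'a::topological_ab_group_add) \<Rightarrow> real \<Rightarrow> 'a \<Rightarrow> complex" where
  "hchar \<beta> x = (THE h. char_extends \<beta> x h)"

definition lambda_dirichlet_group ::
    "(nat \<Rightarrow> real) \<Rightarrow> (real \<Rightarrow> 'a::{topological_ab_group_add, t2_space}) \<Rightarrow> bool" where
  "lambda_dirichlet_group lam \<beta> \<longleftrightarrow>
     dirichlet_group \<beta> \<and> (\<forall>n. \<exists>h. char_extends \<beta> (lam n) h)"

text \<open>Regularity is not automatic, since the group need not be metrizable.\<close>

definition normalized_haar_measure ::
    "'a::{topological_ab_group_add, t2_space} measure \<Rightarrow> bool" where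
  "normalized_haar_measure m \<longleftrightarrow>
     sets m = sets borel \<and> prob_space m \<and>
     (\<forall>a. \<forall>A\<in>sets m. emeasure m ((+) a ` A) = emeasure m A) \<and>
     (\<forall>A\<in>sets m. emeasure m A = (INF U\<in>{U. open U \<and> A \<subseteq> U}. emeasure m U)) \<and>
     (\<forall>U. open U \<longrightarrow> emeasure m U = (SUP K\<in>{K. compact K \<and> K \<subseteq> U}. emeasure m K))"


section \<open>Function spaces\<close>

text \<open>
  The spaces consist of functions rather than of almost-everywhere classes of functions.
  All norms take values in \<open>[0, \<infinity>]\<close>, and the exponent \<open>p\<close> is an extended real.
\<close>

definition Lp_norm :: "'a measure \<Rightarrow> ennreal \<Rightarrow> ('a \<Rightarrow> complex) \<Rightarrow> ennreal" where
  "Lp_norm m p f =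
     (if p = \<infinity> then esssup m (\<lambda>\<omega>. ennreal (cmod (f \<omega>)))
      else let I = (\<integral>\<^sup>+ \<omega>. ennreal (cmod (f \<omega>) powr enn2real p) \<partial>m)
           in if I = \<infinity> then \<infinity> else ennreal (enn2real I powr (1 / enn2real p)))"

definition Lp_space :: "'a measure \<Rightarrow> ennreal \<Rightarrow> ('a \<Rightarrow> complex) set" where
  "Lp_space m p = {f \<in> borel_measurable m. Lp_norm m p f < \<infinity>}"

definition weak_L1_norm :: "'a measure \<Rightarrow> ('a \<Rightarrow> complex) \<Rightarrow> ennreal" where
  "weak_L1_norm m f =
     (INF C \<in> {C::real. 0 < C \<and>
        (\<forall>\<alpha>>0. emeasure m {\<omega> \<in> space m. \<alpha> < cmod (f \<omega>)} \<le> ennreal (C / \<alpha>))}. ennreal C)"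

definition weak_L1_space :: "'a measure \<Rightarrow> ('a \<Rightarrow> complex) set" where
  "weak_L1_space m = {f \<in> borel_measurable m. weak_L1_norm m f < \<infinity>}"

definition fourier_coeff :: "'a measure \<Rightarrow> ('a \<Rightarrow> complex) \<Rightarrow> ('a \<Rightarrow> complex) \<Rightarrow> complex" where
  "fourier_coeff m f \<gamma> = (LINT \<omega>|m. f \<omega> * cnj (\<gamma> \<omega>))"

definition Hp_space ::
    "'a::topological_ab_group_add measure \<Rightarrow> (real \<Rightarrow> 'a) \<Rightarrow> (nat \<Rightarrow> real) \<Rightarrow> ennreal \<Rightarrow>
     ('a \<Rightarrow> complex) set" where
  "Hp_space m \<beta> lam p =
     {f \<in> Lp_space m p.
        \<forall>\<gamma>. character \<gamma> \<and> fourier_coeff m f \<gamma> \<noteq> 0 \<longrightarrow> (\<exists>n. \<gamma> = hchar \<beta> (lam n))}"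


section \<open>Maximal operators\<close>

text \<open>The supremum is taken in \<open>[0, \<infinity>]\<close>, as it may be infinite on a null set.\<close>

definition riesz_max ::
    "'a::topological_ab_group_add measure \<Rightarrow> (real \<Rightarrow> 'a) \<Rightarrow> (nat \<Rightarrow> real) \<Rightarrow> real \<Rightarrow>
     ('a \<Rightarrow> complex) \<Rightarrow> 'a \<Rightarrow> ennreal" where
  "riesz_max m \<beta> lam k f \<omega> =
     (SUP x\<in>{0<..}. ennreal (cmod (\<Sum>n | lam n < x.
        fourier_coeff m f (hchar \<beta> (lam n)) * complex_of_real ((1 - lam n / x) powr k)
          * hchar \<beta> (lam n) \<omega>)))"

text \<open>
  An operator \<open>T\<close> with values in the \<open>[0, \<infinity>]\<close>-valued functions is regarded as an operator
  from \<open>X\<close> to \<open>Y\<close> if it respects equality almost everywhere and if, for \<open>f \<in> X\<close>, the function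
  \<open>T f\<close> is finite almost everywhere and (set to zero where it is infinite) belongs to \<open>Y\<close>.
\<close>

definition complex_version :: "('a \<Rightarrow> ennreal) \<Rightarrow> 'a \<Rightarrow> complex" where
  "complex_version g \<omega> = complex_of_real (enn2real (g \<omega>))"

definition bounded_sublinear_operator ::
    "'a measure \<Rightarrow> ('a \<Rightarrow> complex) set \<Rightarrow> (('a \<Rightarrow> complex) \<Rightarrow> ennreal) \<Rightarrow>
     ('a \<Rightarrow> complex) set \<Rightarrow> (('a \<Rightarrow> complex) \<Rightarrow> ennreal) \<Rightarrow>
     (('a \<Rightarrow> complex) \<Rightarrow> 'a \<Rightarrow> ennreal) \<Rightarrow> bool" where
  "bounded_sublinear_operator m X norm_X Y norm_Y T \<longleftrightarrow>
     (\<forall>f\<in>X. \<forall>g\<in>X. (AE \<omega> in m. f \<omega> = g \<omega>) \<longrightarrow> (AE \<omega> in m. T f \<omega> = T g \<omega>)) \<and>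
     (\<forall>f\<in>X. (AE \<omega> in m. T f \<omega> < \<infinity>) \<and> complex_version (T f) \<in> Y) \<and>
     (\<forall>f\<in>X. \<forall>g\<in>X. AE \<omega> in m. T (\<lambda>v. f v + g v) \<omega> \<le> T f \<omega> + T g \<omega>) \<and>
     (\<forall>f\<in>X. \<forall>c::complex. AE \<omega> in m. T (\<lambda>v. c * f v) \<omega> = ennreal (cmod c) * T f \<omega>) \<and>
     (\<exists>C::real. 0 \<le> C \<and>
        (\<forall>f\<in>X. norm_Y (complex_version (T f)) \<le> ennreal C * norm_X f))"

end

theory Submission
  imports Defs "HOL-Real_Asymp.Real_Asymp"
begin

text \<open>
  The function \<open>(1 - u)\<^sub>+\<^sup>k\<close> is on \<open>u \<ge> 0\<close> a superposition of tents supported in \<open>u \<le> 1\<close>, of total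
  mass \<open>1/k\<close> up to a constant. The Fourier transform of a tent is a modulated Fejer kernel, so the
  Riesz means of a trigonometric polynomial on \<open>G\<close> are dominated by its averages along the flow
  \<open>\<omega> \<mapsto> \<beta> t + \<omega>\<close>, which obey a maximal inequality by Garsia's argument. A general \<open>f\<close> is replaced
  by averages of its translates, with weights \<open>|D|\<^sup>2/|A|\<close> where \<open>D\<close> sums the characters in a finite
  Folner set \<open>A\<close> of frequencies: this yields polynomials whose coefficients tend to those of \<open>f\<close>
  and whose excess \<open>\<integral> (|g| - a)\<^sub>+\<close> is at most that of \<open>f\<close>. The bound
  \<open>m {R f > C a} \<le> (2/a) \<integral> (|f| - a)\<^sub>+\<close> so obtained contains the weak-type estimate, the
  \<open>L\<^sub>\<infinity>\<close> estimate and, by integration over \<open>a\<close>, all the \<open>L\<^sub>p\<close> estimates.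
\<close>

section \<open>The Fejer kernel\<close>

text \<open>The cut is therefore made on the modulus of a polynomial \<open>g\<close> along the
  flow. From |g| \<le> a + (|g| - a)_+ all flow averages of |g| are at most 2a off a set controlled
  by the excess, and \<open>a\<close> remains a free parameter. The excess is a convex functional,
  so averaging against probability densities cannot increase it. Polynomials are used because along
  each orbit they are finite exponential sums, whose Riesz means are explicit integrals against tent
  transforms. They need not converge to \<open>f\<close> in norm: a Riesz sum has finitely many
  terms, so convergence of coefficients suffices, and the exceptional sets pass to the limit through
  their lower limit. The condition \<open>k > 0\<close> enters through the mass 1/k of e^(-ku) on u
  \<ge> 0. Nonnegativity of the frequencies matters because the superposition of tents reproduces (1
  - y)_+^k only for y \<ge> 0.\<close>

lemma has_integral_one_minus_cos:
  "has_bochner_integral lborel (\<lambda>t::real. (1 - cos t) / t\<^sup>2) pi"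
proof -
  \<comment> \<open>Integration by parts gives this antiderivative of the integrand on t > 0; its
    limits are 0 at 0 and \<pi>/2 at infinity.\<close>
  let ?F = "\<lambda>t. Si t - (1 - cos t) / t"
  have d: "DERIV ?F x :> (1 - cos x) / x\<^sup>2" if "0 < x" for x
    using that
    by (auto intro!: derivative_eq_intros DERIV_Si simp: field_simps power2_eq_square)
  have lim0: "(?F \<longlongrightarrow> 0) (at_right 0)"
  proof -
    have "(Si \<longlongrightarrow> Si 0) (at_right 0)"
      using isCont_Si[of 0] by (auto simp: isCont_def intro: tendsto_within_subset)
    moreover have "((\<lambda>t::real. (1 - cos t) / t) \<longlongrightarrow> 0) (at_right 0)"
      by real_asymp
    moreover have "Si 0 = 0" by (simp add: Si_def zero_ereal_def)
    ultimately show ?thesis using tendsto_diff by fastforce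
  qed
  have limi: "(?F \<longlongrightarrow> pi / 2) at_top"
  proof -
    have "((\<lambda>t::real. (1 - cos t) / t) \<longlongrightarrow> 0) at_top"
      by real_asymp
    from tendsto_diff[OF Si_at_top this] show ?thesis by simp
  qed
  have I: "set_integrable lborel (einterval 0 \<infinity>) (\<lambda>t::real. (1 - cos t) / t\<^sup>2)"
    "(LBINT x=0..\<infinity>. (1 - cos x) / x\<^sup>2) = pi / 2 - 0"
  proof -
    note * = interval_integral_FTC_nonneg[of 0 \<infinity> ?F "\<lambda>t. (1 - cos t) / t\<^sup>2" 0 "pi / 2"]
    have "((?F \<circ> real_of_ereal) \<longlongrightarrow> 0) (at_right 0)"
      using lim0 by (simp only: zero_ereal_def ereal_tendsto_simps)
    moreover have "((?F \<circ> real_of_ereal) \<longlongrightarrow> pi / 2) (at_left \<infinity>)"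
      using limi by (simp only: ereal_tendsto_simps)
    ultimately show "set_integrable lborel (einterval 0 \<infinity>) (\<lambda>t::real. (1 - cos t) / t\<^sup>2)"
      "(LBINT x=0..\<infinity>. (1 - cos x) / x\<^sup>2) = pi / 2 - 0"
      by (intro *; use d in \<open>auto intro!: continuous_intros\<close>)+
  qed
  \<comment> \<open>The endpoint makes no difference: at \<open>x = 0\<close> the quotient is 0 / 0
    = 0.\<close>
  have ae: "AE x in lborel. indicator {0..} x *\<^sub>R ((1 - cos x) / x\<^sup>2)
      = indicator (einterval 0 \<infinity>) x *\<^sub>R ((1 - cos x) / x\<^sup>2)"
    by (rule AE_I2) (auto simp: indicator_def einterval_def)
  have "has_bochner_integral lborel (\<lambda>x. indicator (einterval 0 \<infinity>) x *\<^sub>R ((1 - cos x) / x\<^sup>2)) (pi / 2)"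
    using I by (auto simp: has_bochner_integral_iff set_integrable_def interval_lebesgue_integral_def
      set_lebesgue_integral_def)
  then have "has_bochner_integral lborel (\<lambda>x. indicator {0..} x *\<^sub>R ((1 - cos x) / x\<^sup>2)) (pi / 2)"
    by (rule has_bochner_integral_cong_AE[THEN iffD1, rotated 3])
      (use ae in \<open>auto simp: einterval_eq\<close>)
  from has_bochner_integral_even_function[OF this]
  show ?thesis by simp
qed

lemma has_integral_one_minus_cos_scale:
  "has_bochner_integral lborel (\<lambda>t::real. (1 - cos (a * t)) / t\<^sup>2) (pi * \<bar>a\<bar>)"
proof (cases "a = 0")
  case False
  have "has_bochner_integral lborel (\<lambda>t. (1 - cos (0 + a * t)) / (0 + a * t)\<^sup>2) (pi /\<^sub>R \<bar>a\<bar>)"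
    using False by (intro lborel_has_bochner_integral_real_affine_iff[THEN iffD1]
      has_integral_one_minus_cos) auto
  then have "has_bochner_integral lborel (\<lambda>t. a\<^sup>2 * ((1 - cos (0 + a * t)) / (0 + a * t)\<^sup>2))
      (a\<^sup>2 * (pi /\<^sub>R \<bar>a\<bar>))"
    by (rule has_bochner_integral_mult_right)
  moreover have "a\<^sup>2 * (pi /\<^sub>R \<bar>a\<bar>) = pi * \<bar>a\<bar>"
    using False by (simp add: field_simps power2_eq_square flip: abs_mult)
  moreover have "a\<^sup>2 * ((1 - cos (0 + a * t)) / (0 + a * t)\<^sup>2) = (1 - cos (a * t)) / t\<^sup>2" for t
    using False by (simp add: power_mult_distrib)
  ultimately show ?thesis by (simp only:)
qed (simp add: has_bochner_integral_zero)

text \<open>The Fejer kernel of the line, (2/\<pi>) (sin(t/2) / t)^2, with integral 1. Division by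
  zero gives \<open>fejer 0 = 0\<close> instead of the continuous value 1/(2\<pi>), a change on a
  null set.\<close>

definition fejer :: "real \<Rightarrow> real" where
  "fejer t = (1 - cos t) / (pi * t\<^sup>2)"

definition tent :: "real \<Rightarrow> real" where
  "tent u = max 0 (1 - \<bar>u\<bar>)"

lemma fejer_nonneg: "0 \<le> fejer t"
  by (simp add: fejer_def)

lemma fejer_even [simp]: "fejer (- t) = fejer t"
  by (simp add: fejer_def)

lemma fejer_measurable [measurable]: "fejer \<in> borel_measurable borel"
  unfolding fejer_def[abs_def] by measurable

lemma tent_measurable [measurable]: "tent \<in> borel_measurable borel"
  unfolding tent_def[abs_def] by measurable

lemma tent_nonneg: "0 \<le> tent u"
  by (simp add: tent_def)

lemma tent_minus [simp]: "tent (- u) = tent u"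
  by (simp add: tent_def)

text \<open>The bounds 1 - cos t \<le> t^2 / 2 and 1 - cos t \<le> 2, the latter times t^2, add up
  to 5/2 t^2, which \<open>pi > 3\<close> absorbs.\<close>

lemma fejer_le: "fejer t \<le> 1 / (1 + t\<^sup>2)"
proof (cases "t = 0")
  case False
  have s: "1 - cos t = 2 * (sin (t/2))\<^sup>2"
    using cos_double_sin[of "t/2"] by simp
  have "(sin (t/2))\<^sup>2 \<le> (t/2)\<^sup>2"
    using abs_sin_x_le_abs_x[of "t/2"] by (metis abs_le_square_iff)
  then have "1 - cos t \<le> t\<^sup>2 / 2" by (simp add: s power_divide)
  moreover have "(1 - cos t) * t\<^sup>2 \<le> 2 * t\<^sup>2"
    using cos_ge_minus_one[of t] by (intro mult_right_mono) (linarith, simp)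
  ultimately have "(1 - cos t) * (1 + t\<^sup>2) \<le> 3 * t\<^sup>2"
    using zero_le_power2[of t] by (simp only: distrib_left mult_1_right)
  also have "\<dots> \<le> pi * t\<^sup>2"
    using pi_gt3 by (intro mult_right_mono) auto
  finally show ?thesis using False
    by (simp add: fejer_def field_simps add_pos_nonneg)
qed (simp add: fejer_def)

text \<open>The tent is half the second difference of |u|, and \<pi>|u| is the integral of (1 -
  cos(ut)) / t^2. The same second difference applied to the integrands produces the factor 1 - cos
  t.\<close>

lemma has_integral_fejer_cos:
  "has_bochner_integral lborel (\<lambda>t. fejer t * cos (u * t)) (tent u)"
proof -
  let ?g = "\<lambda>a t::real. (1 - cos (a * t)) / t\<^sup>2"
  have "has_bochner_integral lborel
     (\<lambda>t. (1 / (2*pi)) * ((?g (u + 1) t + ?g (u - 1) t) - 2 * ?g u t))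
     ((1 / (2*pi)) * ((pi * \<bar>u + 1\<bar> + pi * \<bar>u - 1\<bar>) - 2 * (pi * \<bar>u\<bar>)))"
    by (intro has_bochner_integral_mult_right has_bochner_integral_diff has_bochner_integral_add
      has_integral_one_minus_cos_scale)
  also have "(\<lambda>t. (1 / (2*pi)) * ((?g (u + 1) t + ?g (u - 1) t) - 2 * ?g u t))
      = (\<lambda>t. fejer t * cos (u * t))"
  proof
    fix t
    have "cos ((u+1)*t) + cos ((u-1)*t) = 2 * cos (u*t) * cos t"
      by (simp add: algebra_simps cos_add cos_diff)
    then have c: "(1 - cos ((u+1)*t)) + (1 - cos ((u-1)*t)) - 2 * (1 - cos (u*t))
        = 2 * ((1 - cos t) * cos (u*t))"
      by (simp add: algebra_simps)
    have "(1 / (2*pi)) * ((?g (u + 1) t + ?g (u - 1) t) - 2 * ?g u t) = (1 / (2*pi)) *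
        (((1 - cos ((u+1)*t)) + (1 - cos ((u-1)*t)) - 2 * (1 - cos (u*t))) / t\<^sup>2)"
      by (simp add: add_divide_distrib diff_divide_distrib)
    also have "\<dots> = fejer t * cos (u * t)"
      unfolding c by (simp add: fejer_def)
    finally show "(1 / (2*pi)) * ((?g (u + 1) t + ?g (u - 1) t) - 2 * ?g u t) = fejer t * cos (u * t)" .
  qed
  also have "(1 / (2*pi)) * ((pi * \<bar>u + 1\<bar> + pi * \<bar>u - 1\<bar>) - 2 * (pi * \<bar>u\<bar>)) = tent u"
    by (auto simp: tent_def field_simps max_def abs_if)
  finally show ?thesis .
qed

lemma fejer_integrable: "integrable lborel fejer"
  using has_integral_fejer_cos[of 0] by (simp add: has_bochner_integral_iff)

lemma fejer_transform:
  "has_bochner_integral lborel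
     (\<lambda>t. complex_of_real (fejer t) * exp (- (\<i> * complex_of_real u * complex_of_real t)))
     (complex_of_real (tent u))"
proof -
  have i: "integrable lborel (\<lambda>t. fejer t * sin (u * t))"
    by (rule Bochner_Integration.integrable_bound[OF fejer_integrable])
      (auto simp: abs_mult fejer_nonneg mult_left_le)
  define S where "S = (LINT t|lborel. fejer t * sin (u * t))"
  \<comment> \<open>The sine part is odd: the substitution t -> -t turns its integral into the
    negative.\<close>
  have "S = (LINT t|lborel. fejer (0 + (-1) * t) * sin (u * (0 + (-1) * t)))"
    unfolding S_def by (subst lborel_integral_real_affine[where c = "-1" and t = 0]) auto
  then have "S = - S" by (simp add: S_def)
  then have S: "has_bochner_integral lborel (\<lambda>t. fejer t * sin (u * t)) 0"
    using i by (simp add: has_bochner_integral_iff S_def)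
  have "has_bochner_integral lborel
     (\<lambda>t. complex_of_real (fejer t * cos (u * t)) - \<i> * complex_of_real (fejer t * sin (u * t)))
     (complex_of_real (tent u) - \<i> * complex_of_real 0)"
    by (intro has_bochner_integral_diff has_bochner_integral_mult_right has_bochner_integral_of_real
      has_integral_fejer_cos S)
  moreover have "complex_of_real (fejer t * cos (u * t)) - \<i> * complex_of_real (fejer t * sin (u * t))
     = complex_of_real (fejer t) * exp (- (\<i> * complex_of_real u * complex_of_real t))" for t
    using cis_conv_exp[of "- (u * t)"]
    by (simp add: complex_eq_iff Re_exp Im_exp)
  ultimately show ?thesis by simp
qed

section \<open>Riesz means along the real line\<close>

lemma nn_integral_exp_atLeast:
  fixes q a :: real
  assumes "0 < q"
  shows "(\<integral>\<^sup>+x. ennreal (q * exp (- q * x)) * indicator {a..} x \<partial>lborel) = ennreal (exp (- q * a))"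
proof -
  have "((\<lambda>x. - exp (- q * x)) \<longlongrightarrow> 0) at_top"
    using assms by real_asymp
  then have "(\<integral>\<^sup>+x. ennreal (q * exp (- q * x)) * indicator {a..} x \<partial>lborel)
      = ennreal (0 - (- exp (- q * a)))"
    using assms by (intro nn_integral_FTC_atLeast) (auto intro!: derivative_eq_intros)
  then show ?thesis by simp
qed

text \<open>The dilated kernel is dominated by a sum over j of indicators of [0, 2^j / b), and the
  average over the j-th interval enters with total weight 4 (1/2)^j. Hence the constant 8, whatever
  the width \<open>b\<close>.\<close>

lemma nn_integral_fejer_le:
  fixes \<psi> :: "real \<Rightarrow> ennreal"
  assumes [measurable]: "\<psi> \<in> borel_measurable borel"
    and avg: "\<And>r. 0 < r \<Longrightarrow> (\<integral>\<^sup>+t. \<psi> t * indicator {0..<r} t \<partial>lborel) \<le> ennreal (\<alpha> * r)"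
    and "0 \<le> \<alpha>" "0 < b"
  shows "(\<integral>\<^sup>+t. \<psi> t * indicator {0..} t * ennreal (b * fejer (b * t)) \<partial>lborel) \<le> ennreal (8 * \<alpha>)"
proof -
  have pt: "\<psi> t * indicator {0..} t * ennreal (b * fejer (b * t))
      \<le> (\<Sum>j. ennreal (4 * b * (1/4)^j) * (\<psi> t * indicator {0..<2^j / b} t))" for t
  proof (cases "0 \<le> t")
    case True
    define s where "s = b * t"
    have s: "0 \<le> s" using True \<open>0 < b\<close> by (simp add: s_def)
    \<comment> \<open>For j > 0 minimality gives 2^(j-1) \<le> s, hence 1 / (1 + s^2) \<le> 4
      (1/4)^j; j = 0 means s < 1.\<close>
    define j where "j = (LEAST j::nat. s < 2^j)"
    have "\<exists>j::nat. s < 2^j"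
      using real_arch_pow[of 2 s] by simp
    then have j: "s < 2^j" unfolding j_def by (rule LeastI_ex)
    have "fejer s \<le> 4 * (1/4)^j"
    proof (cases j)
      case 0
      have "1 / (1 + s\<^sup>2) \<le> 1" by (simp add: add_pos_nonneg)
      then show ?thesis using fejer_le[of s] 0 by simp
    next
      case (Suc i)
      have "\<not> s < 2^i" using not_less_Least[of i "\<lambda>j. s < 2^j"] Suc by (simp add: j_def)
      then have "(2^i)\<^sup>2 \<le> s\<^sup>2" by (intro power_mono) auto
      also have "(2^i)\<^sup>2 = (4::real)^i" by (metis mult_2_right numeral_Bit0 power2_eq_square power_mult_distrib)
      finally have "1 / (1 + s\<^sup>2) \<le> 1 / 4^i" by (intro divide_left_mono mult_pos_pos add_pos_nonneg) auto
      then show ?thesis using fejer_le[of s] Suc by (simp add: power_one_over)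
    qed
    then have f: "b * fejer (b * t) \<le> 4 * b * (1/4)^j"
      using \<open>0 < b\<close> by (simp add: s_def)
    have ind: "indicator {0..<2^j / b} t = (1::ennreal)"
      using True j \<open>0 < b\<close> by (simp add: s_def field_simps)
    have "\<psi> t * indicator {0..} t * ennreal (b * fejer (b * t))
        \<le> ennreal (4 * b * (1/4)^j) * (\<psi> t * indicator {0..<2^j / b} t)"
      using True f unfolding ind by (simp add: mult.commute mult_left_mono ennreal_leI)
    also have "\<dots> = (\<Sum>j\<in>{j}. ennreal (4 * b * (1/4)^j) * (\<psi> t * indicator {0..<2^j / b} t))"
      by simp
    also have "\<dots> \<le> (\<Sum>j. ennreal (4 * b * (1/4)^j) * (\<psi> t * indicator {0..<2^j / b} t))"
      by (rule sum_le_suminf) auto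
    finally show ?thesis .
  qed simp
  have "(\<integral>\<^sup>+t. \<psi> t * indicator {0..} t * ennreal (b * fejer (b * t)) \<partial>lborel)
      \<le> (\<integral>\<^sup>+t. (\<Sum>j. ennreal (4 * b * (1/4)^j) * (\<psi> t * indicator {0..<2^j / b} t)) \<partial>lborel)"
    by (intro nn_integral_mono pt)
  also have "\<dots> = (\<Sum>j. ennreal (4 * b * (1/4)^j) * (\<integral>\<^sup>+t. \<psi> t * indicator {0..<2^j / b} t \<partial>lborel))"
    by (subst nn_integral_suminf) (auto simp: nn_integral_cmult)
  also have "\<dots> \<le> (\<Sum>j. ennreal (4 * b * (1/4)^j) * ennreal (\<alpha> * (2^j / b)))"
    using \<open>0 < b\<close> by (intro suminf_le mult_left_mono avg) auto
  also have "\<dots> = (\<Sum>j. ennreal (4 * \<alpha> * (1/2)^j))"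
  proof (intro suminf_cong)
    fix j
    have "(1/4::real)^j * 2^j = (1/2)^j" by (simp flip: power_mult_distrib)
    then have "4 * b * (1/4)^j * (\<alpha> * (2^j / b)) = 4 * \<alpha> * (1/2)^j"
      using \<open>0 < b\<close> by simp
    then show "ennreal (4 * b * (1/4)^j) * ennreal (\<alpha> * (2^j / b)) = ennreal (4 * \<alpha> * (1/2)^j)"
      using \<open>0 < b\<close> \<open>0 \<le> \<alpha>\<close> by (simp flip: ennreal_mult)
  qed
  also have "\<dots> = ennreal (4 * \<alpha> * 2)"
    using \<open>0 \<le> \<alpha>\<close> geometric_sums[of "1/2::real"]
    by (intro suminf_ennreal_eq sums_mult) auto
  finally show ?thesis by simp
qed

text \<open>The shifted tent is the transform of \<open>b * fejer (b * t)\<close> modulated by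
  e^(iat). The modulation has modulus 1, so the bound does not see the centre \<open>a\<close>. Each
  half-line contributes \<open>8 * \<alpha>\<close>.\<close>

lemma tent_sum_le:
  fixes c :: "'i \<Rightarrow> complex" and l :: "'i \<Rightarrow> real" and I :: "'i set"
  defines "\<phi> \<equiv> \<lambda>t. \<Sum>i\<in>I. c i * exp (- (\<i> * complex_of_real (l i) * complex_of_real t))"
  assumes "finite I" "0 \<le> \<alpha>" "0 < b"
    and avg: "\<And>r. 0 < r \<Longrightarrow> (\<integral>\<^sup>+t. ennreal (cmod (\<phi> t)) * indicator {0..<r} t \<partial>lborel) \<le> ennreal (\<alpha> * r)"
      "\<And>r. 0 < r \<Longrightarrow> (\<integral>\<^sup>+t. ennreal (cmod (\<phi> (- t))) * indicator {0..<r} t \<partial>lborel) \<le> ennreal (\<alpha> * r)"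
  shows "cmod (\<Sum>i\<in>I. c i * complex_of_real (tent ((l i - a) / b))) \<le> 16 * \<alpha>"
proof -
  have [measurable]: "\<phi> \<in> borel_measurable borel"
    unfolding \<phi>_def by (intro borel_measurable_continuous_onI continuous_intros)
  let ?e = "\<lambda>t. exp (\<i> * complex_of_real a * complex_of_real t)"
  let ?k = "\<lambda>t. complex_of_real (b * fejer (b * t))"
  have one: "has_bochner_integral lborel
      (\<lambda>t. ?k t * exp (- (\<i> * complex_of_real (l i - a) * complex_of_real t)))
      (complex_of_real (tent ((l i - a) / b)))" for i
  proof -
    let ?f = "\<lambda>t. complex_of_real (fejer t) *
       exp (- (\<i> * complex_of_real ((l i - a) / b) * complex_of_real t))"
    have "has_bochner_integral lborel (\<lambda>t. ?f (0 + b * t))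
        (complex_of_real (tent ((l i - a) / b)) /\<^sub>R \<bar>b\<bar>)"
      using \<open>0 < b\<close> by (intro lborel_has_bochner_integral_real_affine_iff[THEN iffD1] fejer_transform) simp
    then have "has_bochner_integral lborel (\<lambda>t. complex_of_real b * ?f (0 + b * t))
        (complex_of_real b * (complex_of_real (tent ((l i - a) / b)) /\<^sub>R \<bar>b\<bar>))"
      by (rule has_bochner_integral_mult_right)
    moreover have "complex_of_real b * ?f (0 + b * t)
        = ?k t * exp (- (\<i> * complex_of_real (l i - a) * complex_of_real t))" for t
      using \<open>0 < b\<close> by (simp add: mult.assoc)
    moreover have "complex_of_real b * (complex_of_real (tent ((l i - a) / b)) /\<^sub>R \<bar>b\<bar>)
        = complex_of_real (tent ((l i - a) / b))"
      using \<open>0 < b\<close> by (simp add: scaleR_conv_of_real)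
    ultimately show ?thesis by (simp only:)
  qed
  have "has_bochner_integral lborel
      (\<lambda>t. \<Sum>i\<in>I. c i * (?k t * exp (- (\<i> * complex_of_real (l i - a) * complex_of_real t))))
      (\<Sum>i\<in>I. c i * complex_of_real (tent ((l i - a) / b)))"
    by (intro has_bochner_integral_sum has_bochner_integral_mult_right one)
  moreover have "(\<Sum>i\<in>I. c i * (?k t * exp (- (\<i> * complex_of_real (l i - a) * complex_of_real t))))
      = \<phi> t * (?e t * ?k t)" for t
    unfolding \<phi>_def sum_distrib_right
    by (intro sum.cong) (auto simp: algebra_simps simp flip: exp_add)
  ultimately have hb: "has_bochner_integral lborel (\<lambda>t. \<phi> t * (?e t * ?k t))
      (\<Sum>i\<in>I. c i * complex_of_real (tent ((l i - a) / b)))" by simp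
  have ne: "cmod (?e t) = 1" for t
    by simp
  \<comment> \<open>The kernel is even, so reflection moves the negative half-line to
    \<open>\<phi> (- t)\<close>, where the second hypothesis on averages applies.\<close>
  have half: "(\<integral>\<^sup>+t. ennreal (cmod (\<phi> t)) * indicator {..0} t * ennreal (b * fejer (b * t)) \<partial>lborel)
      = (\<integral>\<^sup>+t. ennreal (cmod (\<phi> (- t))) * indicator {0..} t * ennreal (b * fejer (b * t)) \<partial>lborel)"
    by (subst nn_integral_real_affine[where c = "-1" and t = 0])
      (auto intro!: nn_integral_cong simp: indicator_def)
  have "ennreal (cmod (\<Sum>i\<in>I. c i * complex_of_real (tent ((l i - a) / b))))
      \<le> (\<integral>\<^sup>+t. ennreal (cmod (\<phi> t * (?e t * ?k t))) \<partial>lborel)"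
    using hb integral_norm_bound_ennreal[of lborel "\<lambda>t. \<phi> t * (?e t * ?k t)"]
    by (auto simp: has_bochner_integral_iff)
  also have "\<dots> = (\<integral>\<^sup>+t. ennreal (cmod (\<phi> t)) * ennreal (b * fejer (b * t)) \<partial>lborel)"
    using \<open>0 < b\<close> by (intro nn_integral_cong)
      (simp add: norm_mult ne fejer_nonneg ennreal_mult abs_mult)
  also have "\<dots> \<le> (\<integral>\<^sup>+t. ennreal (cmod (\<phi> t)) * indicator {0..} t * ennreal (b * fejer (b * t))
      + ennreal (cmod (\<phi> t)) * indicator {..0} t * ennreal (b * fejer (b * t)) \<partial>lborel)"
    by (intro nn_integral_mono) (auto simp: indicator_def)
  also have "\<dots> = (\<integral>\<^sup>+t. ennreal (cmod (\<phi> t)) * indicator {0..} t * ennreal (b * fejer (b * t)) \<partial>lborel)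
      + (\<integral>\<^sup>+t. ennreal (cmod (\<phi> t)) * indicator {..0} t * ennreal (b * fejer (b * t)) \<partial>lborel)"
    by (rule nn_integral_add) auto
  also have "\<dots> \<le> ennreal (8 * \<alpha>) + ennreal (8 * \<alpha>)"
    unfolding half using assms(3,4) avg by (intro add_mono nn_integral_fejer_le) auto
  finally have "ennreal (cmod (\<Sum>i\<in>I. c i * complex_of_real (tent ((l i - a) / b)))) \<le> ennreal (16 * \<alpha>)"
    using \<open>0 \<le> \<alpha>\<close> by (simp flip: ennreal_plus)
  then show ?thesis using \<open>0 \<le> \<alpha>\<close> by (subst (asm) ennreal_le_iff) auto
qed

text \<open>With s = e^u this is the Mellin integral of s^(-k-1) tent(s - 2) over s > 0. The tent is
  centred at 2 so that its support [1, 3] stays away from 0.\<close>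

definition riesz_const :: "real \<Rightarrow> real" where
  "riesz_const k = (LINT u|lborel. exp (- k * u) * tent (exp u - 2))"

lemma tent_exp_bound:
  assumes "0 < k"
  shows "exp (- k * u) * tent (exp u - 2) \<le> indicator {0..ln 3} u"
proof (cases "u \<in> {0..ln 3}")
  case True
  then have "exp (- k * u) \<le> 1" "tent (exp u - 2) \<le> 1"
    using assms by (auto simp: tent_def)
  then show ?thesis using True by (simp add: mult_le_one tent_nonneg)
next
  case False
  have "exp u \<le> exp 0 \<or> exp (ln 3) \<le> exp u"
    using False by (simp only: exp_le_cancel_iff atLeastAtMost_iff) linarith
  then have "exp u \<le> 1 \<or> 3 \<le> exp u" by simp
  then have "tent (exp u - 2) = 0" unfolding tent_def by linarith
  then show ?thesis by simp
qed

lemma tent_exp_integrable: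
  assumes "0 < k"
  shows "integrable lborel (\<lambda>u. exp (- k * u) * tent (exp u - 2))"
  by (rule Bochner_Integration.integrable_bound[of _ "indicator {0..ln 3} :: real \<Rightarrow> real"])
    (use tent_exp_bound[OF assms] tent_nonneg in \<open>auto simp: abs_mult\<close>)

lemma riesz_const_pos:
  assumes "0 < k"
  shows "0 < riesz_const k"
proof -
  \<comment> \<open>For u between ln 2 and ln (5/2) the argument e^u - 2 lies in [0, 1/2], so the
    tent is at least 1/2 there.\<close>
  let ?c = "exp (- k * ln (5/2)) / 2"
  have l: "ln 2 < ln (5/2::real)" by simp
  have b: "indicator {ln 2..ln (5/2)} u * ?c \<le> exp (- k * u) * tent (exp u - 2)" for u
  proof (cases "u \<in> {ln 2..ln (5/2)}")
    case True
    then have "exp (ln 2) \<le> exp u" "exp u \<le> exp (ln (5/2))"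
      by (simp_all only: exp_le_cancel_iff atLeastAtMost_iff)
    then have "2 \<le> exp u" "exp u \<le> 5/2" by simp_all
    then have "1/2 \<le> tent (exp u - 2)" by (simp add: tent_def)
    moreover have "exp (- k * ln (5/2)) \<le> exp (- k * u)" using True assms by simp
    ultimately have "exp (- k * ln (5/2)) * (1/2) \<le> exp (- k * u) * tent (exp u - 2)"
      by (intro mult_mono) auto
    then show ?thesis using True by simp
  qed (simp add: tent_nonneg)
  have "0 < (ln (5/2) - ln 2) * ?c" using l by simp
  also have "\<dots> = (LINT u|lborel. indicator {ln 2..ln (5/2::real)} u * ?c)"
    using l by simp
  also have "\<dots> \<le> riesz_const k"
    unfolding riesz_const_def using l
    by (intro integral_mono tent_exp_integrable b assms) auto
  finally show ?thesis .
qed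

text \<open>Translating \<open>u\<close> by \<open>ln v\<close> in the integral defining
  \<open>riesz_const k\<close> produces the factor v^k. Restricting to u \<ge> 0 loses nothing when
  \<open>v \<le> 1\<close>: for u < 0 the argument of the tent is then at most -1. For v \<le> 0
  every tent vanishes, which is the cut-off of the Riesz means.\<close>

lemma riesz_superposition:
  assumes "0 < k" "v \<le> 1"
  shows "has_bochner_integral lborel
     (\<lambda>u. indicator {0..} u * exp (- k * u) * tent (exp u * v - 2))
     (riesz_const k * (if 0 < v then v powr k else 0))"
proof (cases "0 < v")
  case True
  let ?F = "\<lambda>u. exp (- k * u) * tent (exp u - 2)"
  have "has_bochner_integral lborel (\<lambda>u. ?F (ln v + 1 * u)) (riesz_const k /\<^sub>R \<bar>1\<bar>)"
    using tent_exp_integrable[OF assms(1)]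
    by (intro lborel_has_bochner_integral_real_affine_iff[THEN iffD1])
      (auto simp: has_bochner_integral_iff riesz_const_def)
  then have "has_bochner_integral lborel (\<lambda>u. v powr k * ?F (ln v + u)) (v powr k * riesz_const k)"
    by (intro has_bochner_integral_mult_right) simp
  moreover have "v powr k * ?F (ln v + u)
      = indicator {0..} u * exp (- k * u) * tent (exp u * v - 2)" for u
  proof -
    have "v powr k * ?F (ln v + u) = exp (- k * u) * tent (exp u * v - 2)"
    proof -
      have "v powr k * exp (- k * (ln v + u)) = exp (- k * u)"
        using True by (simp add: powr_def algebra_simps flip: exp_add)
      moreover have "exp (ln v + u) = exp u * v"
        using True by (simp add: exp_add)
      ultimately show ?thesis by (simp flip: mult.assoc)
    qed
    moreover have "tent (exp u * v - 2) = 0" if "u < 0"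
    proof -
      have "exp u * v \<le> 1 * 1" using that assms(2) True by (intro mult_mono) auto
      then show ?thesis using True by (simp add: tent_def)
    qed
    ultimately show ?thesis by (auto simp: indicator_def not_le)
  qed
  ultimately show ?thesis using True by (simp add: mult.commute)
next
  case False
  have "tent (exp u * v - 2) = 0" for u
  proof -
    have "exp u * v \<le> 0" using False by (simp add: mult_nonneg_nonpos)
    then show ?thesis by (simp add: tent_def)
  qed
  then show ?thesis using False by (simp add: has_bochner_integral_zero)
qed

text \<open>The superposition is used with v = 1 - l/x, which is at most 1 because frequencies are
  nonnegative. Each tent sum is at most \<open>16 * \<alpha>\<close>, and the weights e^(-ku) on u
  \<ge> 0 have mass 1/k.\<close>

lemma riesz_mean_le:
  fixes c :: "'i \<Rightarrow> complex" and l :: "'i \<Rightarrow> real" and I :: "'i set"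
  defines "\<phi> \<equiv> \<lambda>t. \<Sum>i\<in>I. c i * exp (- (\<i> * complex_of_real (l i) * complex_of_real t))"
  assumes "finite I" "0 \<le> \<alpha>" "0 < k" "0 < x" and l: "\<And>i. i \<in> I \<Longrightarrow> 0 \<le> l i"
    and avg: "\<And>r. 0 < r \<Longrightarrow> (\<integral>\<^sup>+t. ennreal (cmod (\<phi> t)) * indicator {0..<r} t \<partial>lborel) \<le> ennreal (\<alpha> * r)"
      "\<And>r. 0 < r \<Longrightarrow> (\<integral>\<^sup>+t. ennreal (cmod (\<phi> (- t))) * indicator {0..<r} t \<partial>lborel) \<le> ennreal (\<alpha> * r)"
  shows "cmod (\<Sum>i | i \<in> I \<and> l i < x. c i * complex_of_real ((1 - l i / x) powr k))
     \<le> 16 / (k * riesz_const k) * \<alpha>"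
proof -
  let ?S = "\<Sum>i | i \<in> I \<and> l i < x. c i * complex_of_real ((1 - l i / x) powr k)"
  let ?w = "\<lambda>u. indicator {0..} u * exp (- k * u) :: real"
  let ?T = "\<lambda>u. \<Sum>i\<in>I. c i * complex_of_real (tent (exp u * (1 - l i / x) - 2))"
  have "has_bochner_integral lborel
     (\<lambda>u. \<Sum>i\<in>I. c i * complex_of_real (?w u * tent (exp u * (1 - l i / x) - 2)))
     (\<Sum>i\<in>I. c i * complex_of_real (riesz_const k * (if 0 < 1 - l i / x then (1 - l i / x) powr k else 0)))"
    using l \<open>0 < k\<close> \<open>0 < x\<close>
    by (intro has_bochner_integral_sum has_bochner_integral_mult_right has_bochner_integral_of_real
      riesz_superposition) auto
  also have "(\<Sum>i\<in>I. c i * complex_of_real (riesz_const k * (if 0 < 1 - l i / x then (1 - l i / x) powr k else 0)))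
      = (\<Sum>i\<in>I. if l i < x then complex_of_real (riesz_const k) * (c i * complex_of_real ((1 - l i / x) powr k)) else 0)"
    using \<open>0 < x\<close> by (intro sum.cong) auto
  also have "\<dots> = complex_of_real (riesz_const k) * ?S"
    using \<open>finite I\<close> by (simp add: sum_distrib_left flip: sum.inter_filter)
  also have "(\<lambda>u. \<Sum>i\<in>I. c i * complex_of_real (?w u * tent (exp u * (1 - l i / x) - 2)))
      = (\<lambda>u. complex_of_real (?w u) * ?T u)"
    by (simp add: sum_distrib_left mult_ac)
  finally have hb: "has_bochner_integral lborel (\<lambda>u. complex_of_real (?w u) * ?T u)
      (complex_of_real (riesz_const k) * ?S)" .
  have T: "cmod (?T u) \<le> 16 * \<alpha>" for u
  proof -
    \<comment> \<open>As a function of the frequency, the tent with parameter \<open>u\<close> has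
      centre x (1 - 2 e^(-u)) and half-width x e^(-u); the sign is irrelevant since tents are
      even.\<close>
    have "exp u * (1 - l i / x) - 2 = - ((l i - x * (1 - 2 * exp (- u))) / (x * exp (- u)))" for i
      using \<open>0 < x\<close> by (simp add: field_simps exp_minus)
    then have "?T u = (\<Sum>i\<in>I. c i * complex_of_real (tent ((l i - x * (1 - 2 * exp (- u))) / (x * exp (- u)))))"
      by simp
    also have "cmod \<dots> \<le> 16 * \<alpha>"
      using avg assms by (intro tent_sum_le) auto
    finally show ?thesis .
  qed
  have "ennreal (cmod (complex_of_real (riesz_const k) * ?S))
      \<le> (\<integral>\<^sup>+u. ennreal (cmod (complex_of_real (?w u) * ?T u)) \<partial>lborel)"
    using hb integral_norm_bound_ennreal[of lborel "\<lambda>u. complex_of_real (?w u) * ?T u"]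
    by (auto simp: has_bochner_integral_iff)
  also have "\<dots> \<le> (\<integral>\<^sup>+u. ennreal (16 * \<alpha> / k) * (ennreal (k * exp (- k * u)) * indicator {0..} u) \<partial>lborel)"
  proof (intro nn_integral_mono)
    fix u
    have "cmod (complex_of_real (?w u) * ?T u) \<le> ?w u * (16 * \<alpha>)"
      using T[of u] by (auto simp: norm_mult abs_mult intro!: mult_left_mono)
    also have "\<dots> = 16 * \<alpha> / k * (k * exp (- k * u)) * indicator {0..} u"
      using \<open>0 < k\<close> by simp
    finally show "ennreal (cmod (complex_of_real (?w u) * ?T u))
        \<le> ennreal (16 * \<alpha> / k) * (ennreal (k * exp (- k * u)) * indicator {0..} u)"
      using \<open>0 < k\<close> \<open>0 \<le> \<alpha>\<close>
      by (auto simp: indicator_def ennreal_leI split: if_splits simp flip: ennreal_mult)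
  qed
  also have "\<dots> = ennreal (16 * \<alpha> / k)"
    using nn_integral_exp_atLeast[OF \<open>0 < k\<close>, of 0] by (simp add: nn_integral_cmult)
  finally have "cmod (complex_of_real (riesz_const k) * ?S) \<le> 16 * \<alpha> / k"
    using \<open>0 < k\<close> \<open>0 \<le> \<alpha>\<close> by (subst (asm) ennreal_le_iff) auto
  then show ?thesis
    using riesz_const_pos[OF \<open>0 < k\<close>] \<open>0 < k\<close>
    by (simp add: norm_mult field_simps)
qed

section \<open>The maximal ergodic theorem for flows\<close>

text \<open>Where \<open>X N\<close> is positive it is at most f + X N o T, and elsewhere it is 0,
  hence at most X N o T. Integrating and cancelling by invariance shows that \<open>f\<close>, which
  is g - \<alpha>, has nonnegative integral over the set where \<open>X N\<close> is
  positive.\<close>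

lemma maximal_ergodic:
  fixes g :: "'a \<Rightarrow> real"
  assumes "prob_space M" and T [measurable]: "T \<in> measurable M M" and pres: "distr M M T = M"
    and g: "integrable M g"
  shows "\<alpha> * measure M {\<omega> \<in> space M. \<exists>n\<le>N. \<alpha> * real n < (\<Sum>j<n. g ((T ^^ j) \<omega>))}
    \<le> (LINT \<omega>|M. \<bar>g \<omega>\<bar>)"
proof -
  interpret prob_space M by fact
  have [measurable]: "g \<in> borel_measurable M" using g by auto
  define f where "f \<omega> = g \<omega> - \<alpha>" for \<omega>
  have f: "integrable M f" unfolding f_def using g by simp
  have comp: "integrable M (\<lambda>\<omega>. h (T \<omega>))" "(LINT \<omega>|M. h (T \<omega>)) = (LINT \<omega>|M. h \<omega>)"
    if "integrable M h" for h :: "'a \<Rightarrow> real"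
  proof -
    have [measurable]: "h \<in> borel_measurable M" using that by auto
    show "integrable M (\<lambda>\<omega>. h (T \<omega>))"
      using that integrable_distr[of T M M h] by (simp add: pres)
    show "(LINT \<omega>|M. h (T \<omega>)) = (LINT \<omega>|M. h \<omega>)"
      using integral_distr[of T M M h] by (simp add: pres)
  qed
  \<comment> \<open>\<open>X n\<close> is the maximum of the first \<open>n\<close> partial sums, the empty sum included.\<close>
  define X where "X = rec_nat (\<lambda>_. 0) (\<lambda>_ h \<omega>. max 0 (f \<omega> + h (T \<omega>)))"
  have X0: "X 0 \<omega> = 0" and XS: "X (Suc n) \<omega> = max 0 (f \<omega> + X n (T \<omega>))" for n \<omega>
    by (simp_all add: X_def)
  have Xi: "integrable M (X n)" for n
  proof (induction n)
    case 0
    then show ?case by (simp add: X_def)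
  next
    case (Suc n)
    have "integrable M (\<lambda>\<omega>. max 0 (f \<omega> + X n (T \<omega>)))"
      using f comp(1)[OF Suc] by (intro integrable_max) auto
    then show ?case by (simp add: X_def)
  qed
  have Xnn: "0 \<le> X n \<omega>" for n \<omega>
    by (cases n) (auto simp: X0 XS)
  have Xmono: "X n \<omega> \<le> X (Suc n) \<omega>" for n \<omega>
  proof (induction n arbitrary: \<omega>)
    case (Suc n)
    show ?case using Suc[of "T \<omega>"] unfolding XS[of "Suc n" \<omega>] XS[of n \<omega>] by linarith
  qed (simp add: X0 Xnn)
  have ge: "n \<le> N \<Longrightarrow> (\<Sum>j<n. f ((T ^^ j) \<omega>)) \<le> X N \<omega>" for n N \<omega>
  proof (induction n arbitrary: N \<omega>)
    case (Suc n)
    then obtain K where K: "N = Suc K" "n \<le> K" by (cases N) auto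
    have "(\<Sum>j<Suc n. f ((T ^^ j) \<omega>)) = f \<omega> + (\<Sum>j<n. f ((T ^^ j) (T \<omega>)))"
      by (subst sum.lessThan_Suc_shift) (simp add: funpow_swap1)
    also have "\<dots> \<le> f \<omega> + X K (T \<omega>)" using Suc.IH[OF K(2)] by simp
    finally show ?case by (simp add: K XS)
  qed (simp add: Xnn)
  let ?E = "{\<omega> \<in> space M. 0 < X N \<omega>}"
  have [measurable]: "X N \<in> borel_measurable M" using Xi by auto
  have pt: "X N \<omega> - X N (T \<omega>) \<le> indicator ?E \<omega> * f \<omega>" if "\<omega> \<in> space M" for \<omega>
  proof (cases "0 < X N \<omega>")
    case True
    then obtain K where K: "N = Suc K" by (cases N) (auto simp: X0)
    have "X N \<omega> = f \<omega> + X K (T \<omega>)" using True by (auto simp: K XS max_def split: if_splits)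
    then show ?thesis using Xmono[of K "T \<omega>"] True that by (simp add: K)
  next
    case False
    then show ?thesis using Xnn[of N "T \<omega>"] by (simp add: not_less)
  qed
  have "0 = (LINT \<omega>|M. X N \<omega> - X N (T \<omega>))"
    using Xi comp[OF Xi] by simp
  also have "\<dots> \<le> (LINT \<omega>|M. indicator ?E \<omega> * f \<omega>)"
    using f Xi comp[OF Xi] pt
    by (intro integral_mono integrable_real_mult_indicator[where f = f, unfolded mult.commute[of "f _"]]) auto
  also have "\<dots> \<le> (LINT \<omega>|M. \<bar>g \<omega>\<bar> - \<alpha> * indicator ?E \<omega>)"
  proof (rule integral_mono)
    show "integrable M (\<lambda>\<omega>. indicator ?E \<omega> * f \<omega>)"
      using f by (intro integrable_real_mult_indicator[where f = f, unfolded mult.commute[of "f _"]]) auto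
    show "integrable M (\<lambda>\<omega>. \<bar>g \<omega>\<bar> - \<alpha> * indicator ?E \<omega>)"
      using g by (intro Bochner_Integration.integrable_diff integrable_abs integrable_mult_right
        integrable_real_indicator) (auto simp: emeasure_eq_measure)
  qed (auto simp: f_def indicator_def)
  also have "\<dots> = (LINT \<omega>|M. \<bar>g \<omega>\<bar>) - \<alpha> * measure M ?E"
    using g by (subst Bochner_Integration.integral_diff)
      (auto intro!: integrable_mult_right integrable_real_indicator simp: emeasure_eq_measure)
  finally have E: "\<alpha> * measure M ?E \<le> (LINT \<omega>|M. \<bar>g \<omega>\<bar>)" by simp
  let ?D = "{\<omega> \<in> space M. \<exists>n\<le>N. \<alpha> * real n < (\<Sum>j<n. g ((T ^^ j) \<omega>))}"
  have "?D \<subseteq> ?E"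
  proof safe
    fix \<omega> n assume "n \<le> N" "\<alpha> * real n < (\<Sum>j<n. g ((T ^^ j) \<omega>))"
    then show "0 < X N \<omega>"
      using ge[of n N \<omega>] by (simp add: f_def sum_subtractf mult.commute)
  qed
  then have "measure M ?D \<le> measure M ?E"
    by (intro finite_measure_mono) auto
  moreover have "0 \<le> (LINT \<omega>|M. \<bar>g \<omega>\<bar>)" by simp
  \<comment> \<open>For negative \<open>\<alpha>\<close> the left-hand side is at most 0.\<close>
  ultimately show ?thesis using E
    by (cases "0 \<le> \<alpha>") (meson mult_left_mono order_trans, smt (verit) measure_nonneg mult_nonneg_nonneg mult_minus_left)
qed

text \<open>The discrete theorem is applied to the time-h map and the observable \<open>A h\<close>,
  the orbit integral of \<open>\<phi>\<close> over [0, h). Its ergodic sums are exactly the orbit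
  integrals up to time nh, and its mean is h times that of \<open>\<phi>\<close>, so the step
  cancels from the bound and can be refined.\<close>

lemma maximal_flow:
  fixes T :: "real \<Rightarrow> 'a \<Rightarrow> 'a" and \<phi> :: "'a \<Rightarrow> real"
  assumes "prob_space M" and T [measurable]: "\<And>t. T t \<in> measurable M M"
    and pres: "\<And>t. distr M M (T t) = M"
    and T0: "\<And>\<omega>. T 0 \<omega> = \<omega>" and Tadd: "\<And>s t \<omega>. T (s + t) \<omega> = T s (T t \<omega>)"
    and \<phi> [measurable]: "\<phi> \<in> borel_measurable M"
    and joint [measurable]: "(\<lambda>(\<omega>, t). \<phi> (T t \<omega>)) \<in> borel_measurable (M \<Otimes>\<^sub>M lborel)"
    and nonneg: "\<And>\<omega>. 0 \<le> \<phi> \<omega>" and bound: "\<And>\<omega>. \<phi> \<omega> \<le> B" and "0 < \<alpha>"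
  shows "\<exists>E\<in>sets M. emeasure M E \<le> ennreal (1 / \<alpha>) * (\<integral>\<^sup>+\<omega>. ennreal (\<phi> \<omega>) \<partial>M) \<and>
    (\<forall>\<omega>\<in>space M - E. \<forall>r>0.
      (\<integral>\<^sup>+t. ennreal (\<phi> (T t \<omega>)) * indicator {0..<r} t \<partial>lborel) \<le> ennreal (\<alpha> * r))"
proof -
  interpret prob_space M by fact
  interpret pair_sigma_finite M lborel ..
  define N where "N r \<omega> = (\<integral>\<^sup>+t. ennreal (\<phi> (T t \<omega>)) * indicator {0..<r} t \<partial>lborel)" for r \<omega>
  define A where "A r \<omega> = enn2real (N r \<omega>)" for r \<omega>
  have B: "0 \<le> B" using nonneg[of undefined] bound[of undefined] by simp
  have sec [measurable]: "(\<lambda>t. \<phi> (T t \<omega>)) \<in> borel_measurable borel" if "\<omega> \<in> space M" for \<omega>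
    using measurable_Pair2[OF joint that] by simp
  have N_meas [measurable]: "N r \<in> borel_measurable M" for r
    unfolding N_def by measurable
  have A_meas [measurable]: "A r \<in> borel_measurable M" for r
    unfolding A_def by measurable
  have N_le: "N r \<omega> \<le> ennreal (B * r)" if "0 \<le> r" for r \<omega>
  proof -
    have "N r \<omega> \<le> (\<integral>\<^sup>+t. ennreal B * indicator {0..<r} t \<partial>lborel)"
      unfolding N_def by (intro nn_integral_mono mult_right_mono ennreal_leI bound) simp
    then show ?thesis using that B by (simp add: nn_integral_cmult ennreal_mult)
  qed
  have N_eq: "N r \<omega> = ennreal (A r \<omega>)" if "0 \<le> r" for r \<omega>
    unfolding A_def using le_less_trans[OF N_le[OF that, of \<omega>] ennreal_less_top] by simp
  have A_nonneg: "0 \<le> A r \<omega>" for r \<omega> by (simp add: A_def)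
  have A_bound: "A r \<omega> \<le> B * r" if "0 \<le> r" for r \<omega>
    using N_le[OF that, of \<omega>] that B by (subst (asm) N_eq) auto
  have A_int: "integrable M (A r)" if "0 \<le> r" for r
    using that by (intro integrable_const_bound[where B = "B * r"]) (auto simp: A_nonneg A_bound)
  have N_split: "N (s + r) \<omega> = N s \<omega> + N r (T s \<omega>)" if "0 \<le> s" "0 \<le> r" "\<omega> \<in> space M" for s r \<omega>
  proof -
    note [measurable] = sec[OF that(3)]
    have "N (s + r) \<omega> = (\<integral>\<^sup>+t. ennreal (\<phi> (T t \<omega>)) * indicator {0..<s} t
        + ennreal (\<phi> (T t \<omega>)) * indicator {s..<s+r} t \<partial>lborel)"
      unfolding N_def using that by (intro nn_integral_cong) (auto simp: indicator_def)
    also have "\<dots> = N s \<omega> + (\<integral>\<^sup>+t. ennreal (\<phi> (T t \<omega>)) * indicator {s..<s+r} t \<partial>lborel)"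
      unfolding N_def by (intro nn_integral_add) auto
    also have "(\<integral>\<^sup>+t. ennreal (\<phi> (T t \<omega>)) * indicator {s..<s+r} t \<partial>lborel)
        = (\<integral>\<^sup>+t. ennreal (\<phi> (T (s + 1 * t) \<omega>)) * indicator {s..<s+r} (s + 1 * t) \<partial>lborel)"
      by (subst nn_integral_real_affine[where c = 1 and t = s]) auto
    also have "\<dots> = N r (T s \<omega>)"
      unfolding N_def by (intro nn_integral_cong)
        (auto simp: indicator_def simp flip: Tadd, simp_all add: add.commute)
    finally show ?thesis .
  qed
  have A_split: "A (s + r) \<omega> = A s \<omega> + A r (T s \<omega>)" if "0 \<le> s" "0 \<le> r" "\<omega> \<in> space M" for s r \<omega>
    using N_split[OF that] that N_eq[of s \<omega>] N_eq[of r "T s \<omega>"] A_nonneg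
    by (simp add: A_def[of "s + r"] flip: ennreal_plus)
  have pow: "(T h ^^ j) \<omega> = T (real j * h) \<omega>" for h j \<omega>
    by (induction j) (auto simp: T0 distrib_right simp flip: Tadd)
  have A_sum: "(\<Sum>j<n. A h ((T h ^^ j) \<omega>)) = A (real n * h) \<omega>" if "0 \<le> h" "\<omega> \<in> space M" for n h \<omega>
  proof (induction n)
    case (Suc n)
    then show ?case
      using A_split[of "real n * h" h \<omega>] that by (simp add: pow distrib_right add.commute)
  qed (simp add: A_def N_def)
  have N_int: "(\<integral>\<^sup>+\<omega>. N r \<omega> \<partial>M) = ennreal r * (\<integral>\<^sup>+\<omega>. ennreal (\<phi> \<omega>) \<partial>M)" if "0 \<le> r" for r
  proof -
    have "(\<integral>\<^sup>+\<omega>. N r \<omega> \<partial>M)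
        = (\<integral>\<^sup>+t. (\<integral>\<^sup>+\<omega>. ennreal (\<phi> (T t \<omega>)) * indicator {0..<r} t \<partial>M) \<partial>lborel)"
      unfolding N_def by (rule Fubini'[symmetric]) measurable
    also have "\<dots> = (\<integral>\<^sup>+t. (\<integral>\<^sup>+\<omega>. ennreal (\<phi> \<omega>) \<partial>M) * indicator {0..<r} t \<partial>lborel)"
    proof (intro nn_integral_cong)
      fix t
      have "(\<integral>\<^sup>+\<omega>. ennreal (\<phi> (T t \<omega>)) \<partial>M) = (\<integral>\<^sup>+\<omega>. ennreal (\<phi> \<omega>) \<partial>distr M M (T t))"
        by (subst nn_integral_distr) auto
      then show "(\<integral>\<^sup>+\<omega>. ennreal (\<phi> (T t \<omega>)) * indicator {0..<r} t \<partial>M)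
          = (\<integral>\<^sup>+\<omega>. ennreal (\<phi> \<omega>) \<partial>M) * indicator {0..<r} t"
        by (simp add: pres nn_integral_multc)
    qed
    also have "\<dots> = ennreal r * (\<integral>\<^sup>+\<omega>. ennreal (\<phi> \<omega>) \<partial>M)"
      using that by (subst nn_integral_cmult_indicator) (simp_all add: mult.commute)
    finally show ?thesis .
  qed
  have \<phi>_int: "integrable M \<phi>"
    using nonneg bound by (intro integrable_const_bound[where B = B]) auto
  have A_integral: "(LINT \<omega>|M. A r \<omega>) = r * (LINT \<omega>|M. \<phi> \<omega>)" if "0 \<le> r" for r
  proof -
    have "ennreal (LINT \<omega>|M. A r \<omega>) = (\<integral>\<^sup>+\<omega>. N r \<omega> \<partial>M)"
      using A_int[OF that] N_eq[OF that] A_nonneg by (simp add: nn_integral_eq_integral)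
    also have "\<dots> = ennreal (r * (LINT \<omega>|M. \<phi> \<omega>))"
      using that \<phi>_int nonneg by (simp add: N_int nn_integral_eq_integral ennreal_mult)
    finally show ?thesis using that A_nonneg nonneg by (simp add: integral_nonneg)
  qed
  \<comment> \<open>Steps of length 2^-k, and 4^k of them: the grid becomes finer while the time
    horizon 2^k grows, so the sets increase and catch every \<open>r\<close> at which the average is
    too large.\<close>
  define E where "E k = {\<omega> \<in> space M. \<exists>n\<le>4^k. \<alpha> / 2^k * real n < A (real n / 2^k) \<omega>}" for k :: nat
  have E_meas: "E k \<in> sets M" for k
    unfolding E_def by measurable
  have E_measure: "emeasure M (E k) \<le> ennreal (1 / \<alpha>) * (\<integral>\<^sup>+\<omega>. ennreal (\<phi> \<omega>) \<partial>M)" for k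
  proof -
    let ?h = "1 / 2^k :: real"
    have "E k = {\<omega> \<in> space M. \<exists>n\<le>4^k. \<alpha> * ?h * real n < (\<Sum>j<n. A ?h ((T ?h ^^ j) \<omega>))}"
      unfolding E_def using A_sum[of ?h] by auto
    then have "\<alpha> * ?h * measure M (E k) \<le> (LINT \<omega>|M. \<bar>A ?h \<omega>\<bar>)"
      using maximal_ergodic[OF \<open>prob_space M\<close> T pres A_int[of ?h], of "\<alpha> * ?h" "4^k" ?h] by simp
    then have "\<alpha> * measure M (E k) \<le> (LINT \<omega>|M. \<phi> \<omega>)"
      using A_nonneg by (simp add: A_integral field_simps)
    then have "measure M (E k) \<le> 1 / \<alpha> * (LINT \<omega>|M. \<phi> \<omega>)"
      using \<open>0 < \<alpha>\<close> by (simp add: field_simps)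
    then show ?thesis
      using \<phi>_int nonneg \<open>0 < \<alpha>\<close>
      by (simp add: emeasure_eq_measure nn_integral_eq_integral ennreal_leI flip: ennreal_mult)
  qed
  have E_mono: "incseq E"
  proof (rule incseq_SucI, unfold E_def, safe)
    fix k n \<omega> assume "n \<le> 4^k" and *: "\<alpha> / 2^k * real n < A (real n / 2^k) \<omega>"
    then show "\<exists>n\<le>4^Suc k. \<alpha> / 2^Suc k * real n < A (real n / 2^Suc k) \<omega>"
      by (intro exI[of _ "2 * n"]) auto
  qed
  have "emeasure M (\<Union>k. E k) = (SUP k. emeasure M (E k))"
    using E_meas E_mono by (intro SUP_emeasure_incseq[symmetric]) auto
  then have "emeasure M (\<Union>k. E k) \<le> ennreal (1 / \<alpha>) * (\<integral>\<^sup>+\<omega>. ennreal (\<phi> \<omega>) \<partial>M)"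
    using E_measure by (simp add: SUP_le_iff)
  moreover have "N r \<omega> \<le> ennreal (\<alpha> * r)" if \<omega>: "\<omega> \<in> space M - (\<Union>k. E k)" and "0 < r" for \<omega> r
  proof (rule ccontr)
    assume "\<not> N r \<omega> \<le> ennreal (\<alpha> * r)"
    then have gt: "\<alpha> * r < A r \<omega>"
      using \<open>0 < r\<close> \<open>0 < \<alpha>\<close> by (simp add: N_eq not_le ennreal_less_iff)
    \<comment> \<open>\<open>k1\<close> makes the loss \<alpha> / 2^k from rounding \<open>r\<close>
      up to the grid smaller than the surplus \<open>A r \<omega> - \<alpha> * r\<close>;
      \<open>k2\<close> keeps the number of steps below 4^k.\<close>
    obtain k1 :: nat where k1: "\<alpha> / (A r \<omega> - \<alpha> * r) < 2^k1"
      using real_arch_pow[of 2] by auto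
    obtain k2 :: nat where k2: "r + 1 < 2^k2"
      using real_arch_pow[of 2] by auto
    define k where "k = max k1 k2"
    have "(2::real)^k1 \<le> 2^k" "(2::real)^k2 \<le> 2^k" by (auto simp: k_def intro!: power_increasing)
    with k1 k2 have k: "\<alpha> / (A r \<omega> - \<alpha> * r) < 2^k" "r + 1 < 2^k" by linarith+
    define n where "n = nat \<lceil>2^k * r\<rceil>"
    have n: "2^k * r \<le> real n" "real n \<le> 2^k * r + 1"
      using \<open>0 < r\<close> by (auto simp: n_def of_nat_ceiling)
    have "(1::real) \<le> 2^k" by simp
    then have "2^k * r + 1 \<le> 2^k * (r + 1)" by (simp add: distrib_left)
    with n(2) have "real n \<le> 2^k * (r + 1)" by (rule order_trans)
    also have "\<dots> \<le> 2^k * 2^k" using k(2) by (intro mult_left_mono) auto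
    also have "\<dots> = (4::real)^k" by (simp flip: power_mult_distrib)
    finally have n4: "n \<le> 4^k" by (metis of_nat_le_iff of_nat_numeral of_nat_power)
    have "\<alpha> / 2^k * real n \<le> \<alpha> / 2^k * (2^k * r + 1)"
      using n(2) \<open>0 < \<alpha>\<close> by (intro mult_left_mono) auto
    also have "\<dots> = \<alpha> * r + \<alpha> / 2^k" by (simp add: field_simps)
    also have "\<dots> < A r \<omega>" using k(1) gt by (simp add: field_simps)
    also have "\<dots> \<le> A (real n / 2^k) \<omega>"
    proof -
      have "r \<le> real n / 2^k" using n(1) by (simp add: field_simps)
      then have "A (r + (real n / 2^k - r)) \<omega> \<ge> A r \<omega>"
        using \<open>0 < r\<close> \<omega> A_nonneg by (subst A_split) auto
      then show ?thesis by simp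
    qed
    finally have "\<omega> \<in> E k" using n4 \<omega> unfolding E_def by blast
    then show False using \<omega> by auto
  qed
  ultimately show ?thesis
    using E_meas unfolding N_def by (intro bexI[of _ "\<Union>k. E k"]) auto
qed

section \<open>Characters of Dirichlet groups and Folner means\<close>

lemma borel_measurable_cnj [measurable (raw)]:
  "f \<in> borel_measurable M \<Longrightarrow> (\<lambda>x. cnj (f x)) \<in> borel_measurable M"
  by (rule borel_measurable_continuous_on[where f = cnj]) (intro continuous_intros)

text \<open>The sums with at most N copies of each l n number at most (N+1)^J, so they cannot grow
  by the factor 1 + \<epsilon> at every stage. Where they do not, A and l n + A both lie in the next
  stage, and inclusion-exclusion leaves an overlap of at least 2|A| - (1 + \<epsilon>)|A|.\<close>

lemma folner_reals:
  fixes l :: "nat \<Rightarrow> real" and S :: "real set"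
  assumes "0 \<in> S" and add: "\<And>x y. x \<in> S \<Longrightarrow> y \<in> S \<Longrightarrow> x + y \<in> S"
    and l: "\<And>n. n < J \<Longrightarrow> l n \<in> S" and "0 < \<epsilon>"
  shows "\<exists>A. finite A \<and> A \<noteq> {} \<and> A \<subseteq> S \<and>
    (\<forall>n<J. (1 - \<epsilon>) * real (card A) \<le> real (card (A \<inter> (+) (l n) ` A)))"
proof -
  let ?f = "\<lambda>c. \<Sum>n<J. real (c n) * l n"
  let ?P = "\<lambda>N. {..<J} \<rightarrow>\<^sub>E {..N::nat}"
  define A where "A N = ?f ` ?P N" for N
  have fin: "finite (A N)" for N
    unfolding A_def by (intro finite_imageI finite_PiE) auto
  have ne: "A N \<noteq> {}" for N
    unfolding A_def by (auto simp: PiE_eq_empty_iff)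
  have sub: "A N \<subseteq> S" for N
  proof -
    have m: "real c * x \<in> S" if "x \<in> S" for c x
      by (induction c) (auto simp: \<open>0 \<in> S\<close> distrib_right intro!: add that)
    have "(\<Sum>n<i. real (c n) * l n) \<in> S" if "i \<le> J" for i and c :: "nat \<Rightarrow> nat"
      using that by (induction i) (auto simp: \<open>0 \<in> S\<close> intro!: add m l)
    then show ?thesis by (auto simp: A_def)
  qed
  have card_le: "card (A N) \<le> (N + 1)^J" for N
  proof -
    have "card (A N) \<le> card (?P N)"
      unfolding A_def by (intro card_image_le finite_PiE) auto
    then show ?thesis by (simp add: card_PiE)
  qed
  have mono: "A N \<subseteq> A (Suc N)" for N
    unfolding A_def by (intro image_mono PiE_mono) auto
  have shift: "(+) (l n) ` A N \<subseteq> A (Suc N)" if "n < J" for n N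
  proof safe
    fix x assume "x \<in> A N"
    then obtain c where c: "c \<in> ?P N" "x = ?f c" by (auto simp: A_def)
    have "?f (c(n := Suc (c n))) = real (Suc (c n)) * l n + (\<Sum>i\<in>{..<J} - {n}. real (c i) * l i)"
      using that by (subst sum.remove[of _ n]) (auto intro!: sum.cong)
    also have "\<dots> = l n + ?f c"
      using that by (subst (2) sum.remove[of _ n]) (auto simp: distrib_right)
    finally show "l n + x \<in> A (Suc N)"
      unfolding A_def c(2) using c(1) that
      by (intro image_eqI[of _ _ "c(n := Suc (c n))"]) (auto simp: PiE_iff extensional_def le_SucI)
  qed
  have "\<exists>N. real (card (A (Suc N))) \<le> (1 + \<epsilon>) * real (card (A N))"
  proof (rule ccontr)
    assume "\<not> ?thesis"
    then have step: "(1 + \<epsilon>) * real (card (A N)) \<le> real (card (A (Suc N)))" for N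
      by (auto simp: not_le less_imp_le)
    have low: "(1 + \<epsilon>)^N \<le> real (card (A N))" for N
    proof (induction N)
      case 0
      then show ?case using fin[of 0] ne[of 0] by (simp add: Suc_le_eq card_gt_0_iff)
    next
      case (Suc N)
      have "(1 + \<epsilon>)^Suc N \<le> (1 + \<epsilon>) * real (card (A N))"
        using Suc \<open>0 < \<epsilon>\<close> by simp
      also note step[of N]
      finally show ?case .
    qed
    have "(\<lambda>N. real (N + 1)^J / (1 + \<epsilon>)^N) \<longlonglongrightarrow> 0"
      using \<open>0 < \<epsilon>\<close> by real_asymp
    then have "eventually (\<lambda>N. real (N + 1)^J / (1 + \<epsilon>)^N < 1) sequentially"
      by (rule order_tendstoD) simp
    then obtain N where "real (N + 1)^J / (1 + \<epsilon>)^N < 1"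
      by (auto simp: eventually_sequentially)
    then have "real (N + 1)^J < (1 + \<epsilon>)^N"
      using \<open>0 < \<epsilon>\<close> by (simp add: field_simps)
    moreover have "real (card (A N)) \<le> real (N + 1)^J"
      using card_le[of N] by (metis of_nat_le_iff of_nat_power)
    ultimately show False using low[of N] by simp
  qed
  then obtain N where N: "real (card (A (Suc N))) \<le> (1 + \<epsilon>) * real (card (A N))" by blast
  have "(1 - \<epsilon>) * real (card (A N)) \<le> real (card (A N \<inter> (+) (l n) ` A N))" if "n < J" for n
  proof -
    have "card (A N) + card ((+) (l n) ` A N)
        = card (A N \<union> (+) (l n) ` A N) + card (A N \<inter> (+) (l n) ` A N)"
      using fin by (intro card_Un_Int) auto
    moreover have "card ((+) (l n) ` A N) = card (A N)"
      by (intro card_image) (auto simp: inj_on_def)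
    moreover have "card (A N \<union> (+) (l n) ` A N) \<le> card (A (Suc N))"
      using fin mono shift[OF that] by (intro card_mono) auto
    ultimately have "2 * real (card (A N)) \<le> real (card (A (Suc N))) + real (card (A N \<inter> (+) (l n) ` A N))"
      by linarith
    with N show ?thesis by (simp add: algebra_simps)
  qed
  then show ?thesis using fin[of N] ne[of N] sub[of N] by (intro exI[of _ "A N"]) simp
qed

section \<open>Haar measure, orthogonality of characters, Folner kernels\<close>

locale dirichlet_haar =
  fixes \<beta> :: "real \<Rightarrow> 'a::{topological_ab_group_add, t2_space}" and m :: "'a measure"
  assumes dirichlet: "dirichlet_group \<beta>" and haar: "normalized_haar_measure m"
begin

lemma sets_m: "sets m = sets borel"
  using haar by (simp add: normalized_haar_measure_def)

lemma space_m [simp]: "space m = UNIV"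
  using sets_eq_imp_space_eq[OF sets_m] by simp

sublocale prob_space m
  using haar by (simp add: normalized_haar_measure_def)

lemma prob_UNIV [simp]: "prob UNIV = 1"
  using prob_space by simp

lemma translate_measurable [measurable]: "(+) a \<in> measurable m m"
proof -
  have "(+) a \<in> borel_measurable borel"
    by (intro borel_measurable_continuous_onI continuous_intros)
  then show ?thesis
    by (simp add: measurable_cong_sets[OF sets_m sets_m])
qed

lemma distr_translate: "distr m m ((+) a) = m"
proof (rule measure_eqI)
  fix A assume "A \<in> sets (distr m m ((+) a))"
  then have A: "A \<in> sets m" by simp
  \<comment> \<open>Invariance is given for images, while \<open>distr\<close> needs
    preimages.\<close>
  have "(+) a -` A = (+) (- a) ` A"
    by (force simp: image_iff)
  moreover have "emeasure m ((+) (- a) ` A) = emeasure m A"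
  proof -
    from haar have "\<forall>a. \<forall>A\<in>sets m. emeasure m ((+) a ` A) = emeasure m A"
      unfolding normalized_haar_measure_def by (elim conjE)
    then show ?thesis using A by blast
  qed
  ultimately show "emeasure (distr m m ((+) a)) A = emeasure m A"
    using A by (simp add: emeasure_distr)
qed simp

lemma \<beta>_add: "\<beta> (s + t) = \<beta> s + \<beta> t"
  using dirichlet by (simp add: dirichlet_group_def)

lemma \<beta>_0 [simp]: "\<beta> 0 = 0"
  using \<beta>_add[of 0 0] by simp

definition freqs :: "real set" where
  "freqs = {x. \<exists>h. char_extends \<beta> x h}"

text \<open>Two extensions agree on a closed set containing the dense range of
  \<open>\<beta>\<close>; this makes the definite description in \<open>hchar\<close>
  usable.\<close>

lemma hchar_eqI:
  assumes "char_extends \<beta> x h"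
  shows "hchar \<beta> x = h"
  unfolding hchar_def
proof (rule the_equality)
  fix h' assume h': "char_extends \<beta> x h'"
  have "closed {w. h' w = h w}"
    using assms h' by (intro closed_Collect_eq) (auto simp: char_extends_def character_def)
  moreover have "range \<beta> \<subseteq> {w. h' w = h w}"
    using assms h' by (auto simp: char_extends_def)
  ultimately have "closure (range \<beta>) \<subseteq> {w. h' w = h w}"
    by (rule closure_minimal[rotated])
  then show "h' = h" using dirichlet by (auto simp: dirichlet_group_def)
qed (rule assms)

lemma char_extends_hchar: "x \<in> freqs \<Longrightarrow> char_extends \<beta> x (hchar \<beta> x)"
  using hchar_eqI by (auto simp: freqs_def)

lemma
  assumes "x \<in> freqs"
  shows character_hchar: "character (hchar \<beta> x)"
    and hchar_\<beta>: "hchar \<beta> x (\<beta> t) = exp (- (\<i> * complex_of_real x * complex_of_real t))"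
    and hchar_add: "hchar \<beta> x (v + w) = hchar \<beta> x v * hchar \<beta> x w"
    and norm_hchar: "cmod (hchar \<beta> x w) = 1"
    and continuous_hchar: "continuous_on UNIV (hchar \<beta> x)"
  using char_extends_hchar[OF assms] by (auto simp: char_extends_def character_def)

lemma hchar_measurable: "x \<in> freqs \<Longrightarrow> hchar \<beta> x \<in> borel_measurable m"
  using borel_measurable_continuous_onI[OF continuous_hchar]
  by (simp add: measurable_cong_sets[OF sets_m refl])

lemma freqs_0: "0 \<in> freqs" and hchar_0: "hchar \<beta> 0 w = 1"
proof -
  have *: "char_extends \<beta> 0 (\<lambda>_. 1)" by (simp add: char_extends_def character_def)
  then show "0 \<in> freqs" by (auto simp: freqs_def)
  show "hchar \<beta> 0 w = 1" using hchar_eqI[OF *] by simp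
qed

lemma
  assumes "x \<in> freqs" "y \<in> freqs"
  shows freqs_add: "x + y \<in> freqs"
    and freqs_diff: "x - y \<in> freqs"
    and hchar_diff: "hchar \<beta> (x - y) w = hchar \<beta> x w * cnj (hchar \<beta> y w)"
proof -
  note h = character_hchar[OF assms(1)] character_hchar[OF assms(2)]
    hchar_\<beta>[OF assms(1)] hchar_\<beta>[OF assms(2)]
  have "char_extends \<beta> (x + y) (\<lambda>w. hchar \<beta> x w * hchar \<beta> y w)"
    using h unfolding char_extends_def character_def
    by (auto intro!: continuous_intros simp: norm_mult algebra_simps simp flip: exp_add)
  then show "x + y \<in> freqs" by (auto simp: freqs_def)
  have *: "char_extends \<beta> (x - y) (\<lambda>w. hchar \<beta> x w * cnj (hchar \<beta> y w))"
    using h unfolding char_extends_def character_def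
    by (auto intro!: continuous_intros simp: norm_mult algebra_simps exp_cnj simp flip: exp_add)
  then show "x - y \<in> freqs" by (auto simp: freqs_def)
  show "hchar \<beta> (x - y) w = hchar \<beta> x w * cnj (hchar \<beta> y w)" using hchar_eqI[OF *] by simp
qed

text \<open>Translation by \<beta>(\<pi>/x) preserves the measure and multiplies the character by
  e^(-i\<pi>) = -1, so the integral equals its own negative.\<close>

lemma integral_hchar:
  assumes x: "x \<in> freqs"
  shows "(LINT w|m. hchar \<beta> x w) = (if x = 0 then 1 else 0)"
proof (cases "x = 0")
  case True
  then show ?thesis by (simp add: hchar_0)
next
  case False
  define t where "t = pi / x"
  have [measurable]: "hchar \<beta> x \<in> borel_measurable m" using x by (rule hchar_measurable)
  have e0: "\<i> * complex_of_real x * complex_of_real t = \<i> * complex_of_real pi"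
    using False by (simp add: t_def)
  then have e: "hchar \<beta> x (\<beta> t) = - 1"
    by (simp only: hchar_\<beta>[OF x] e0) (simp add: exp_minus)
  have "(LINT w|m. hchar \<beta> x w) = (LINT w|distr m m ((+) (\<beta> t)). hchar \<beta> x w)"
    by (simp add: distr_translate)
  also have "\<dots> = (LINT w|m. hchar \<beta> x (\<beta> t + w))"
    by (rule integral_distr) auto
  also have "\<dots> = - (LINT w|m. hchar \<beta> x w)"
    by (simp add: hchar_add[OF x] e)
  finally show ?thesis using False by simp
qed

text \<open>For \<open>A\<close> inside \<open>freqs\<close> this is |D(w - v)|^2 / |A| with D the
  sum of the characters in \<open>A\<close>. It is written through products of characters in the two
  variables because subtraction need not be measurable for the product of the Borel sigma-algebras
  when the group is not second countable.\<close>

definition fkernel :: "real set \<Rightarrow> 'a \<Rightarrow> 'a \<Rightarrow> real" where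
  "fkernel A w v = (cmod (\<Sum>\<mu>\<in>A. hchar \<beta> \<mu> w * cnj (hchar \<beta> \<mu> v)))\<^sup>2 / real (card A)"

text \<open>The convolution of \<open>f\<close> with the kernel, given by its expansion so that it
  is visibly a trigonometric polynomial. Collecting equal differences, the coefficient at x is
  multiplied by |A \<inter> (x + A)| / |A|.\<close>

definition fmean :: "real set \<Rightarrow> ('a \<Rightarrow> complex) \<Rightarrow> 'a \<Rightarrow> complex" where
  "fmean A f w = (\<Sum>(\<mu>, \<nu>)\<in>A \<times> A. fourier_coeff m f (hchar \<beta> (\<mu> - \<nu>)) / of_nat (card A)
     * hchar \<beta> (\<mu> - \<nu>) w)"

lemma fkernel_nonneg: "0 \<le> fkernel A w v"
  by (simp add: fkernel_def)

lemma fkernel_commute: "fkernel A w v = fkernel A v w"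
proof -
  have "(\<Sum>\<mu>\<in>A. hchar \<beta> \<mu> w * cnj (hchar \<beta> \<mu> v)) = cnj (\<Sum>\<mu>\<in>A. hchar \<beta> \<mu> v * cnj (hchar \<beta> \<mu> w))"
    by (simp add: mult.commute)
  then have "cmod (\<Sum>\<mu>\<in>A. hchar \<beta> \<mu> w * cnj (hchar \<beta> \<mu> v)) = cmod (\<Sum>\<mu>\<in>A. hchar \<beta> \<mu> v * cnj (hchar \<beta> \<mu> w))"
    by (simp only: complex_mod_cnj)
  then show ?thesis by (simp only: fkernel_def)
qed

lemma fkernel_eq:
  assumes "A \<subseteq> freqs"
  shows "complex_of_real (fkernel A w v)
    = (\<Sum>(\<mu>, \<nu>)\<in>A \<times> A. hchar \<beta> (\<mu> - \<nu>) w * cnj (hchar \<beta> (\<mu> - \<nu>) v) / of_nat (card A))"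
proof -
  have "complex_of_real (fkernel A w v)
      = (\<Sum>\<mu>\<in>A. hchar \<beta> \<mu> w * cnj (hchar \<beta> \<mu> v))
        * cnj (\<Sum>\<mu>\<in>A. hchar \<beta> \<mu> w * cnj (hchar \<beta> \<mu> v)) / of_nat (card A)"
    unfolding fkernel_def of_real_divide complex_norm_square by simp
  also have "\<dots> = (\<Sum>\<mu>\<in>A. \<Sum>\<nu>\<in>A. hchar \<beta> (\<mu> - \<nu>) w * cnj (hchar \<beta> (\<mu> - \<nu>) v) / of_nat (card A))"
    unfolding cnj_sum sum_product sum_divide_distrib using assms
    by (intro sum.cong refl) (auto simp: hchar_diff subset_iff)
  finally show ?thesis by (simp add: sum.cartesian_product)
qed

lemma fkernel_measurable:
  assumes "A \<subseteq> freqs"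
  shows "(\<lambda>(w, v). fkernel A w v) \<in> borel_measurable (m \<Otimes>\<^sub>M m)"
proof -
  have [measurable]: "hchar \<beta> \<mu> \<in> borel_measurable m" if "\<mu> \<in> A" for \<mu>
    using that assms hchar_measurable by auto
  show ?thesis unfolding fkernel_def by measurable
qed

lemma fkernel_measurable1: "A \<subseteq> freqs \<Longrightarrow> (\<lambda>v. fkernel A w v) \<in> borel_measurable m"
  using measurable_Pair2[OF fkernel_measurable, of A w] by simp

lemma fkernel_bound:
  assumes "A \<subseteq> freqs"
  shows "fkernel A w v \<le> real (card A)"
proof -
  have "cmod (\<Sum>\<mu>\<in>A. hchar \<beta> \<mu> w * cnj (hchar \<beta> \<mu> v)) \<le> (\<Sum>\<mu>\<in>A. 1)"
    using assms by (intro sum_norm_le) (auto simp: norm_mult norm_hchar subset_iff)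
  then have "(cmod (\<Sum>\<mu>\<in>A. hchar \<beta> \<mu> w * cnj (hchar \<beta> \<mu> v)))\<^sup>2 \<le> (real (card A))\<^sup>2"
    by (intro power_mono) auto
  then show ?thesis
    unfolding fkernel_def by (cases "card A = 0") (auto simp: divide_le_eq power2_eq_square)
qed

lemma fkernel_integrable: "A \<subseteq> freqs \<Longrightarrow> integrable m (\<lambda>v. fkernel A w v)"
  by (rule integrable_const_bound[where B = "real (card A)", OF AE_I2])
    (simp_all add: fkernel_nonneg fkernel_bound fkernel_measurable1)

lemma fmean_eq_integral:
  assumes "A \<subseteq> freqs" "integrable m f"
  shows "fmean A f w = (LINT v|m. f v * complex_of_real (fkernel A w v))"
    and "integrable m (\<lambda>v. f v * complex_of_real (fkernel A w v))"
proof -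
  have [measurable]: "f \<in> borel_measurable m" using assms by auto
  have i: "integrable m (\<lambda>v. f v * cnj (hchar \<beta> x v))" if "x \<in> freqs" for x
  proof (rule Bochner_Integration.integrable_bound[OF assms(2)])
    have [measurable]: "hchar \<beta> x \<in> borel_measurable m" using that by (rule hchar_measurable)
    show "(\<lambda>v. f v * cnj (hchar \<beta> x v)) \<in> borel_measurable m" by measurable
  qed (auto simp: norm_mult norm_hchar[OF that])
  have "f v * complex_of_real (fkernel A w v) = (\<Sum>(\<mu>, \<nu>)\<in>A \<times> A.
      hchar \<beta> (\<mu> - \<nu>) w / of_nat (card A) * (f v * cnj (hchar \<beta> (\<mu> - \<nu>) v)))" for v
    unfolding fkernel_eq[OF assms(1)] sum_distrib_left by (intro sum.cong) auto
  moreover have "has_bochner_integral m (\<lambda>v. \<Sum>(\<mu>, \<nu>)\<in>A \<times> A.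
      hchar \<beta> (\<mu> - \<nu>) w / of_nat (card A) * (f v * cnj (hchar \<beta> (\<mu> - \<nu>) v)))
      (\<Sum>(\<mu>, \<nu>)\<in>A \<times> A. hchar \<beta> (\<mu> - \<nu>) w / of_nat (card A) * fourier_coeff m f (hchar \<beta> (\<mu> - \<nu>)))"
    unfolding case_prod_beta using assms(1)
    by (intro has_bochner_integral_sum has_bochner_integral_mult_right)
      (auto simp: has_bochner_integral_iff fourier_coeff_def intro!: i freqs_diff)
  ultimately show "fmean A f w = (LINT v|m. f v * complex_of_real (fkernel A w v))"
    "integrable m (\<lambda>v. f v * complex_of_real (fkernel A w v))"
    by (auto simp: has_bochner_integral_iff fmean_def mult_ac)
qed

text \<open>Orthogonality leaves the |A| diagonal pairs, each of weight 1/|A|. With the symmetry of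
  the kernel this gives a probability density in either variable.\<close>

lemma integral_fkernel:
  assumes "A \<subseteq> freqs" "finite A" "A \<noteq> {}"
  shows "(LINT v|m. fkernel A w v) = 1"
proof -
  have c: "fourier_coeff m (\<lambda>_. 1) (hchar \<beta> (\<mu> - \<nu>)) = (if \<mu> = \<nu> then 1 else 0)"
    if "\<mu> \<in> A" "\<nu> \<in> A" for \<mu> \<nu>
    using that assms integral_hchar[OF freqs_diff, of \<mu> \<nu>]
    by (auto simp: fourier_coeff_def subset_iff)
  have "complex_of_real (LINT v|m. fkernel A w v) = fmean A (\<lambda>_. 1) w"
    using fmean_eq_integral(1)[OF assms(1), of "\<lambda>_. 1"] by simp
  also have "\<dots> = (\<Sum>\<mu>\<in>A. \<Sum>\<nu>\<in>A. if \<mu> = \<nu> then 1 / of_nat (card A) else 0)"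
    unfolding fmean_def sum.cartesian_product[symmetric]
    by (intro sum.cong refl) (auto simp: c hchar_0)
  also have "\<dots> = 1" using assms by simp
  finally show ?thesis by simp
qed

text \<open>This is Jensen's inequality for the convex function (|z| - a)_+, with the kernel as
  density in \<open>v\<close>, followed by Fubini with the kernel as density in \<open>w\<close>. As
  \<open>ennreal\<close> sends negative reals to 0, \<open>ennreal (cmod z - a)\<close> is this
  positive part.\<close>

lemma fmean_excess_le:
  assumes A: "A \<subseteq> freqs" "finite A" "A \<noteq> {}" and f: "integrable m f"
  shows "(\<integral>\<^sup>+w. ennreal (cmod (fmean A f w) - a) \<partial>m) \<le> (\<integral>\<^sup>+v. ennreal (cmod (f v) - a) \<partial>m)"
proof -
  interpret pair_sigma_finite m m ..
  have [measurable]: "f \<in> borel_measurable m" using f by auto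
  note [measurable] = fkernel_measurable1[OF A(1)] fkernel_measurable[OF A(1)]
  have pt: "ennreal (cmod (fmean A f w) - a) \<le> (\<integral>\<^sup>+v. ennreal (cmod (f v) - a) * ennreal (fkernel A w v) \<partial>m)" for w
  proof -
    have fi: "integrable m (\<lambda>v. cmod (f v) * fkernel A w v)"
      using integrable_norm[OF fmean_eq_integral(2)[OF A(1) f, of w]]
      by (simp add: norm_mult fkernel_nonneg)
    let ?h = "\<lambda>v. (cmod (f v) - a) * fkernel A w v"
    have hi: "integrable m ?h"
      unfolding left_diff_distrib using fi fkernel_integrable[OF A(1)] by simp
    have "cmod (fmean A f w) \<le> (LINT v|m. cmod (f v) * fkernel A w v)"
      unfolding fmean_eq_integral(1)[OF A(1) f]
      using integral_norm_bound[of m "\<lambda>v. f v * complex_of_real (fkernel A w v)"]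
      by (simp add: norm_mult fkernel_nonneg)
    then have "cmod (fmean A f w) - a \<le> (LINT v|m. cmod (f v) * fkernel A w v) - a * (LINT v|m. fkernel A w v)"
      using A by (simp add: integral_fkernel)
    also have "\<dots> = (LINT v|m. ?h v)"
      unfolding left_diff_distrib using fi fkernel_integrable[OF A(1)] by simp
    also have "\<dots> \<le> (LINT v|m. max 0 (?h v))"
      using hi by (intro integral_mono) auto
    finally have "ennreal (cmod (fmean A f w) - a) \<le> ennreal (LINT v|m. max 0 (?h v))"
      by (rule ennreal_leI)
    also have "\<dots> = (\<integral>\<^sup>+v. ennreal (max 0 (?h v)) \<partial>m)"
      using hi by (intro nn_integral_eq_integral[symmetric]) auto
    also have "\<dots> = (\<integral>\<^sup>+v. ennreal (cmod (f v) - a) * ennreal (fkernel A w v) \<partial>m)"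
      using fkernel_nonneg[of A w]
      by (intro nn_integral_cong) (auto simp: max_def ennreal_mult' ennreal_neg ennreal_mult'' not_le
        simp flip: ennreal_mult'')
    finally show ?thesis .
  qed
  have "(\<integral>\<^sup>+w. ennreal (cmod (fmean A f w) - a) \<partial>m)
      \<le> (\<integral>\<^sup>+w. (\<integral>\<^sup>+v. ennreal (cmod (f v) - a) * ennreal (fkernel A w v) \<partial>m) \<partial>m)"
    by (intro nn_integral_mono pt)
  also have "\<dots> = (\<integral>\<^sup>+v. (\<integral>\<^sup>+w. ennreal (cmod (f v) - a) * ennreal (fkernel A w v) \<partial>m) \<partial>m)"
    by (rule Fubini'[symmetric]) measurable
  also have "\<dots> = (\<integral>\<^sup>+v. ennreal (cmod (f v) - a) \<partial>m)"
  proof (intro nn_integral_cong)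
    fix v
    have "(\<integral>\<^sup>+w. ennreal (fkernel A w v) \<partial>m) = ennreal (LINT w|m. fkernel A v w)"
      using fkernel_integrable[OF A(1)] fkernel_nonneg
      by (subst fkernel_commute) (intro nn_integral_eq_integral, auto)
    then have "(\<integral>\<^sup>+w. ennreal (fkernel A w v) \<partial>m) = 1" using A by (simp add: integral_fkernel)
    moreover have "(\<lambda>w. fkernel A w v) \<in> borel_measurable m"
      by (subst fkernel_commute) measurable
    ultimately show "(\<integral>\<^sup>+w. ennreal (cmod (f v) - a) * ennreal (fkernel A w v) \<partial>m) = ennreal (cmod (f v) - a)"
      by (simp add: nn_integral_cmult)
  qed
  finally show ?thesis .
qed

end

section \<open>The weak-type estimate\<close>

lemma frequency_finite:
  assumes "frequency lam"
  shows "finite {n. lam n < x}"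
proof -
  obtain N where "x < lam N"
    using assms by (auto simp: frequency_def bdd_above_def not_le)
  then have "{n. lam n < x} \<subseteq> {..<N}"
    using assms by (auto simp: frequency_def intro!: strict_mono_less[THEN iffD1, of lam])
  then show ?thesis by (rule finite_subset) simp
qed

context dirichlet_haar
begin

text \<open>If the characters coincide, the one of x - y is constantly 1 and has integral 1, which
  orthogonality allows only for x - y = 0.\<close>

lemma hchar_inj:
  assumes "x \<in> freqs" "y \<in> freqs" "hchar \<beta> x = hchar \<beta> y"
  shows "x = y"
proof -
  have "hchar \<beta> (x - y) w = 1" for w
    using assms by (simp add: hchar_diff norm_hchar flip: complex_norm_square)
  then show ?thesis
    using integral_hchar[OF freqs_diff[OF assms(1,2)]] by (auto split: if_splits)
qed

end

section \<open>The Riesz maximal function and its weak-type bound\<close>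

locale dirichlet_riesz = dirichlet_haar +
  fixes lam :: "nat \<Rightarrow> real" and k :: real
  assumes freq: "frequency lam" and k: "0 < k" and lam_freqs: "lam n \<in> freqs"
begin

abbreviation R :: "('a \<Rightarrow> complex) \<Rightarrow> 'a \<Rightarrow> ennreal" where
  "R \<equiv> riesz_max m \<beta> lam k"

definition riesz_sum :: "('a \<Rightarrow> complex) \<Rightarrow> real \<Rightarrow> 'a \<Rightarrow> complex" where
  "riesz_sum f x \<omega> = (\<Sum>n | lam n < x. fourier_coeff m f (hchar \<beta> (lam n))
     * complex_of_real ((1 - lam n / x) powr k) * hchar \<beta> (lam n) \<omega>)"

text \<open>A common domain for all exponents: the measure being finite, every
  \<open>Hp_space\<close> with exponent at least 1 is contained in it.\<close>

definition H1 :: "('a \<Rightarrow> complex) set" where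
  "H1 = {f. integrable m f \<and> (\<forall>\<gamma>. character \<gamma> \<and> fourier_coeff m f \<gamma> \<noteq> 0 \<longrightarrow> (\<exists>n. \<gamma> = hchar \<beta> (lam n)))}"

lemma R_eq: "R f \<omega> = (SUP x\<in>{0<..}. ennreal (cmod (riesz_sum f x \<omega>)))"
  by (simp add: riesz_max_def riesz_sum_def)

lemma riesz_sum_continuous: "continuous_on UNIV (riesz_sum f x)"
  unfolding riesz_sum_def[abs_def]
  by (intro continuous_intros continuous_hchar lam_freqs)

text \<open>The supremum is over uncountably many \<open>x\<close>, so measurability comes from
  topology: a supremum of continuous functions is lower semicontinuous and its superlevel sets are
  open.\<close>

lemma R_level_measurable: "{\<omega>. y < R f \<omega>} \<in> sets m"
proof -
  have "open {\<omega>. y < ennreal (cmod (riesz_sum f x \<omega>))}" for x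
    by (intro open_Collect_less continuous_intros riesz_sum_continuous continuous_on_ennreal)
  then have "open (\<Union>x\<in>{0<..}. {\<omega>. y < ennreal (cmod (riesz_sum f x \<omega>))})"
    by (intro open_UN) auto
  also have "(\<Union>x\<in>{0<..}. {\<omega>. y < ennreal (cmod (riesz_sum f x \<omega>))}) = {\<omega>. y < R f \<omega>}"
    by (auto simp: R_eq less_SUP_iff)
  finally show ?thesis by (simp add: sets_m)
qed

lemma R_measurable [measurable]: "R f \<in> borel_measurable m"
  by (rule borel_measurableI_greater) (simp add: R_level_measurable)

lemma H1_coeff:
  assumes "f \<in> H1" "x \<in> freqs" "fourier_coeff m f (hchar \<beta> x) \<noteq> 0"
  shows "\<exists>n. x = lam n"
proof -
  obtain n where "hchar \<beta> x = hchar \<beta> (lam n)"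
    using assms character_hchar[OF assms(2)] unfolding H1_def by blast
  then show ?thesis using hchar_inj[OF assms(2) lam_freqs] by blast
qed

text \<open>Pairs are grouped by their difference. Those with difference \<open>lam n\<close>
  correspond, via the first component, to the points of \<open>A\<close> in lam n + A; a difference
  that is no frequency has coefficient 0.\<close>

lemma fmean_sum_reindex:
  assumes f: "f \<in> H1" and A: "A \<subseteq> freqs" "finite A"
  shows "(\<Sum>p | p \<in> {p \<in> A \<times> A. 0 \<le> fst p - snd p} \<and> fst p - snd p < x.
      fourier_coeff m f (hchar \<beta> (fst p - snd p)) * F (fst p - snd p))
    = (\<Sum>n | lam n < x. of_nat (card (A \<inter> (+) (lam n) ` A)) * (fourier_coeff m f (hchar \<beta> (lam n)) * F (lam n)))"
    (is "?L = ?R")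
proof -
  let ?c = "\<lambda>y. fourier_coeff m f (hchar \<beta> y) * F y"
  let ?Q = "{p \<in> A \<times> A. 0 \<le> fst p - snd p \<and> fst p - snd p < x}"
  have lam0: "0 \<le> lam n" for n using freq by (simp add: frequency_def)
  have inj: "lam i = lam j \<longleftrightarrow> i = j" for i j
    using freq by (auto simp: frequency_def strict_mono_eq)
  have fin: "finite ?Q" "finite {n. lam n < x}"
    using A frequency_finite[OF freq] by auto
  have "?L = (\<Sum>p\<in>?Q. ?c (fst p - snd p))"
    by (rule sum.cong) auto
  also have "\<dots> = (\<Sum>p\<in>?Q. \<Sum>n | lam n < x. if fst p - snd p = lam n then ?c (lam n) else 0)"
  proof (rule sum.cong[OF refl])
    fix p assume p: "p \<in> ?Q"
    then have pf: "fst p - snd p \<in> freqs" using A by (auto intro!: freqs_diff)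
    show "?c (fst p - snd p) = (\<Sum>n | lam n < x. if fst p - snd p = lam n then ?c (lam n) else 0)"
    proof (cases "\<exists>n. fst p - snd p = lam n")
      case True
      then obtain n where n: "fst p - snd p = lam n" by blast
      then show ?thesis using p fin by (simp add: inj)
    next
      case False
      then have "fourier_coeff m f (hchar \<beta> (fst p - snd p)) = 0"
        using H1_coeff[OF f pf] by blast
      then show ?thesis using False by simp
    qed
  qed
  also have "\<dots> = (\<Sum>n | lam n < x. \<Sum>p\<in>?Q. if fst p - snd p = lam n then ?c (lam n) else 0)"
    by (rule sum.swap)
  also have "\<dots> = ?R"
  proof (rule sum.cong[OF refl])
    fix n assume "n \<in> {n. lam n < x}"
    then have "{p \<in> ?Q. fst p - snd p = lam n} = {p \<in> A \<times> A. fst p - snd p = lam n}"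
      using lam0[of n] by auto
    also have "card \<dots> = card (A \<inter> (+) (lam n) ` A)"
    proof (rule bij_betw_same_card[of fst], rule bij_betw_imageI)
      show "inj_on fst {p \<in> A \<times> A. fst p - snd p = lam n}"
        by (auto simp: inj_on_def)
      show "fst ` {p \<in> A \<times> A. fst p - snd p = lam n} = A \<inter> (+) (lam n) ` A"
      proof safe
        fix \<nu> assume "\<nu> \<in> A" "lam n + \<nu> \<in> A"
        then show "lam n + \<nu> \<in> fst ` {p \<in> A \<times> A. fst p - snd p = lam n}"
          by (intro image_eqI[of _ _ "(lam n + \<nu>, \<nu>)"]) auto
      qed (force simp: image_iff algebra_simps)+
    qed
    finally show "(\<Sum>p\<in>?Q. if fst p - snd p = lam n then ?c (lam n) else 0)
        = of_nat (card (A \<inter> (+) (lam n) ` A)) * ?c (lam n)"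
      using fin by (simp flip: sum.inter_filter)
  qed
  finally show ?thesis .
qed

text \<open>The constant of \<open>riesz_mean_le\<close>, doubled because it is applied with
  averages bounded by \<open>2 * a\<close>.\<close>

definition riesz_bound :: real where
  "riesz_bound = 32 / (k * riesz_const k)"

lemma riesz_bound_pos: "0 < riesz_bound"
  using k riesz_const_pos[OF k] by (simp add: riesz_bound_def)

text \<open>The maximal inequality is applied to \<open>\<phi>\<close>, the excess of |g| over
  \<open>a\<close>, and not to |g|: where averages of \<open>\<phi>\<close> are at most
  \<open>a\<close>, those of |g| are at most 2a. Forward and backward time each cost an exceptional
  set, hence 2/a.\<close>

lemma fmean_weak_type:
  assumes f: "f \<in> H1" and A: "A \<subseteq> freqs" "finite A" "A \<noteq> {}" and "0 < a"
  shows "\<exists>E\<in>sets m. emeasure m E \<le> ennreal (2 / a) * (\<integral>\<^sup>+v. ennreal (cmod (f v) - a) \<partial>m) \<and>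
    (\<forall>\<omega>. \<omega> \<notin> E \<longrightarrow> (\<forall>x>0. cmod (\<Sum>n | lam n < x.
        of_nat (card (A \<inter> (+) (lam n) ` A)) / of_nat (card A) *
        (fourier_coeff m f (hchar \<beta> (lam n)) * complex_of_real ((1 - lam n / x) powr k) * hchar \<beta> (lam n) \<omega>))
      \<le> riesz_bound * a))"
proof -
  have fi: "integrable m f" using f by (simp add: H1_def)
  define g where "g = fmean A f"
  define c where "c p = fourier_coeff m f (hchar \<beta> (fst p - snd p)) / of_nat (card A)" for p
  have g: "g \<omega> = (\<Sum>p\<in>A \<times> A. c p * hchar \<beta> (fst p - snd p) \<omega>)" for \<omega>
    unfolding g_def fmean_def c_def by (simp add: case_prod_beta)
  have df: "fst p - snd p \<in> freqs" if "p \<in> A \<times> A" for p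
    using that A by (auto intro!: freqs_diff)
  have hm: "hchar \<beta> (fst p - snd p) \<in> borel_measurable m" if "p \<in> A \<times> A" for p
    by (rule hchar_measurable[OF df[OF that]])
  have g_meas [measurable]: "g \<in> borel_measurable m"
    unfolding g[abs_def] by (intro borel_measurable_sum borel_measurable_times borel_measurable_const hm)
  have g_flow: "g (\<beta> t + \<omega>) = (\<Sum>p\<in>A \<times> A. c p * hchar \<beta> (fst p - snd p) \<omega>
      * exp (- (\<i> * complex_of_real (fst p - snd p) * complex_of_real t)))" for t \<omega>
    unfolding g using df by (intro sum.cong refl) (simp only: hchar_add hchar_\<beta> mult_ac)
  define B where "B = (\<Sum>p\<in>A \<times> A. cmod (c p))"
  have g_bound: "cmod (g \<omega>) \<le> B" for \<omega>
    unfolding g B_def using df by (intro sum_norm_le) (simp add: norm_mult norm_hchar)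
  define \<phi> where "\<phi> \<omega> = max 0 (cmod (g \<omega>) - a)" for \<omega>
  have \<phi>_meas: "\<phi> \<in> borel_measurable m" unfolding \<phi>_def by measurable
  have \<phi>_bound: "\<phi> \<omega> \<le> B" for \<omega>
    using g_bound[of \<omega>] \<open>0 < a\<close> norm_ge_zero[of "g \<omega>"] unfolding \<phi>_def by linarith
  \<comment> \<open>Joint measurability is read off the finite sum in \<open>g_flow\<close>, whose
    terms are products of a function of \<open>\<omega>\<close> and one of \<open>t\<close>.\<close>
  have joint: "(\<lambda>(\<omega>, t). \<phi> ((+) (\<beta> (s * t)) \<omega>)) \<in> borel_measurable (m \<Otimes>\<^sub>M lborel)" for s
  proof -
    have [measurable]: "(\<lambda>x. hchar \<beta> (fst p - snd p) (fst x)) \<in> borel_measurable (m \<Otimes>\<^sub>M lborel)"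
      if "p \<in> A \<times> A" for p
      using measurable_compose[OF measurable_fst hm[OF that]] .
    have "(\<lambda>x. g (\<beta> (s * snd x) + fst x)) \<in> borel_measurable (m \<Otimes>\<^sub>M lborel)"
      unfolding g_flow by (intro borel_measurable_sum) measurable
    then show ?thesis unfolding \<phi>_def by (simp add: case_prod_beta)
  qed
  \<comment> \<open>The sign of \<open>s\<close> selects the direction of time; it is used for 1 and
    -1.\<close>
  have flow: "\<exists>E\<in>sets m. emeasure m E \<le> ennreal (1 / a) * (\<integral>\<^sup>+\<omega>. ennreal (\<phi> \<omega>) \<partial>m) \<and>
    (\<forall>\<omega>\<in>space m - E. \<forall>r>0.
      (\<integral>\<^sup>+t. ennreal (\<phi> (\<beta> (s * t) + \<omega>)) * indicator {0..<r} t \<partial>lborel) \<le> ennreal (a * r))" for s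
  proof (rule maximal_flow[where T = "\<lambda>t. (+) (\<beta> (s * t))" and B = B])
    show "\<beta> (s * (u + t)) + \<omega> = \<beta> (s * u) + (\<beta> (s * t) + \<omega>)" for u t \<omega>
      by (simp add: distrib_left \<beta>_add add.assoc)
  qed (use \<phi>_meas \<phi>_bound joint \<open>0 < a\<close> in \<open>auto simp: distr_translate \<phi>_def prob_space_axioms\<close>)
  have "(\<integral>\<^sup>+\<omega>. ennreal (\<phi> \<omega>) \<partial>m) = (\<integral>\<^sup>+\<omega>. ennreal (cmod (g \<omega>) - a) \<partial>m)"
    by (intro nn_integral_cong) (auto simp: \<phi>_def max_def ennreal_neg)
  also have "\<dots> \<le> (\<integral>\<^sup>+v. ennreal (cmod (f v) - a) \<partial>m)"
    unfolding g_def by (rule fmean_excess_le[OF A fi])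
  finally have ex: "(\<integral>\<^sup>+\<omega>. ennreal (\<phi> \<omega>) \<partial>m) \<le> (\<integral>\<^sup>+v. ennreal (cmod (f v) - a) \<partial>m)" .
  obtain E1 where E1: "E1 \<in> sets m" "emeasure m E1 \<le> ennreal (1 / a) * (\<integral>\<^sup>+\<omega>. ennreal (\<phi> \<omega>) \<partial>m)"
    "\<And>\<omega> r. \<omega> \<notin> E1 \<Longrightarrow> 0 < r \<Longrightarrow>
      (\<integral>\<^sup>+t. ennreal (\<phi> (\<beta> t + \<omega>)) * indicator {0..<r} t \<partial>lborel) \<le> ennreal (a * r)"
    using flow[of 1] by auto
  obtain E2 where E2: "E2 \<in> sets m" "emeasure m E2 \<le> ennreal (1 / a) * (\<integral>\<^sup>+\<omega>. ennreal (\<phi> \<omega>) \<partial>m)"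
    "\<And>\<omega> r. \<omega> \<notin> E2 \<Longrightarrow> 0 < r \<Longrightarrow>
      (\<integral>\<^sup>+t. ennreal (\<phi> (\<beta> (- t) + \<omega>)) * indicator {0..<r} t \<partial>lborel) \<le> ennreal (a * r)"
    using flow[of "-1"] by auto
  have g_meas_flow: "(\<lambda>t. g (\<beta> (s * t) + \<omega>)) \<in> borel_measurable lborel" for s \<omega>
    unfolding g_flow by (intro borel_measurable_sum) measurable
  have avg: "(\<integral>\<^sup>+t. ennreal (cmod (g (\<beta> (s * t) + \<omega>))) * indicator {0..<r} t \<partial>lborel) \<le> ennreal (2 * a * r)"
    if "(\<integral>\<^sup>+t. ennreal (\<phi> (\<beta> (s * t) + \<omega>)) * indicator {0..<r} t \<partial>lborel) \<le> ennreal (a * r)" "0 < r"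
    for \<omega> s r
  proof -
    note [measurable] = g_meas_flow[of s \<omega>]
    have "(\<integral>\<^sup>+t. ennreal (cmod (g (\<beta> (s * t) + \<omega>))) * indicator {0..<r} t \<partial>lborel)
        \<le> (\<integral>\<^sup>+t. ennreal a * indicator {0..<r} t + ennreal (\<phi> (\<beta> (s * t) + \<omega>)) * indicator {0..<r} t \<partial>lborel)"
    proof (intro nn_integral_mono)
      fix t
      have "ennreal (cmod (g w)) \<le> ennreal (a + \<phi> w)" for w
        unfolding \<phi>_def by (intro ennreal_leI) linarith
      also have "ennreal (a + \<phi> w) = ennreal a + ennreal (\<phi> w)" for w
        using \<open>0 < a\<close> by (intro ennreal_plus) (auto simp: \<phi>_def)
      finally show "ennreal (cmod (g (\<beta> (s * t) + \<omega>))) * indicator {0..<r} t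
          \<le> ennreal a * indicator {0..<r} t + ennreal (\<phi> (\<beta> (s * t) + \<omega>)) * indicator {0..<r} t"
        by (simp add: indicator_def)
    qed
    also have "\<dots> = ennreal a * ennreal r + (\<integral>\<^sup>+t. ennreal (\<phi> (\<beta> (s * t) + \<omega>)) * indicator {0..<r} t \<partial>lborel)"
      unfolding \<phi>_def using \<open>0 < r\<close> by (subst nn_integral_add) (auto simp: nn_integral_cmult_indicator)
    also have "\<dots> \<le> ennreal a * ennreal r + ennreal (a * r)"
      using that(1) by (intro add_left_mono)
    also have "\<dots> = ennreal (2 * a * r)"
      using \<open>0 < a\<close> \<open>0 < r\<close> by (simp flip: ennreal_mult ennreal_plus)
    finally show ?thesis .
  qed
  show ?thesis
  proof (intro bexI[of _ "E1 \<union> E2"] conjI allI impI)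
    have "emeasure m (E1 \<union> E2) \<le> emeasure m E1 + emeasure m E2"
      using E1 E2 by (intro emeasure_subadditive) auto
    also have "\<dots> \<le> ennreal (1 / a) * (\<integral>\<^sup>+\<omega>. ennreal (\<phi> \<omega>) \<partial>m) + ennreal (1 / a) * (\<integral>\<^sup>+\<omega>. ennreal (\<phi> \<omega>) \<partial>m)"
      using E1 E2 by (intro add_mono)
    also have "\<dots> = ennreal (2 / a) * (\<integral>\<^sup>+\<omega>. ennreal (\<phi> \<omega>) \<partial>m)"
      using \<open>0 < a\<close> by (simp flip: distrib_right ennreal_plus)
    also have "\<dots> \<le> ennreal (2 / a) * (\<integral>\<^sup>+v. ennreal (cmod (f v) - a) \<partial>m)"
      by (intro mult_left_mono ex) simp
    finally show "emeasure m (E1 \<union> E2) \<le> ennreal (2 / a) * (\<integral>\<^sup>+v. ennreal (cmod (f v) - a) \<partial>m)" .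
  next
    fix \<omega> x assume \<omega>: "\<omega> \<notin> E1 \<union> E2" and x: "(0::real) < x"
    let ?I = "{p \<in> A \<times> A. 0 \<le> fst p - snd p}"
    let ?c = "\<lambda>p. c p * hchar \<beta> (fst p - snd p) \<omega>"
    \<comment> \<open>\<open>fmean\<close> involves differences of both signs, but
      \<open>riesz_mean_le\<close> admits only nonnegative frequencies; the negative ones carry no
      coefficient.\<close>
    have c0: "c p = 0" if "p \<in> A \<times> A - ?I" for p
    proof -
      have "fst p - snd p \<noteq> lam n" for n
        using that freq by (auto simp: frequency_def) (metis le_less_trans less_irrefl not_le diff_ge_0_iff_ge)
      then show ?thesis using H1_coeff[OF f df[of p]] that by (auto simp: c_def)
    qed
    have \<phi>_eq: "(\<Sum>p\<in>?I. ?c p * exp (- (\<i> * complex_of_real (fst p - snd p) * complex_of_real t)))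
        = g (\<beta> t + \<omega>)" for t
      unfolding g_flow using A c0 by (intro sum.mono_neutral_left) auto
    have "(\<Sum>n | lam n < x.
        of_nat (card (A \<inter> (+) (lam n) ` A)) / of_nat (card A) *
        (fourier_coeff m f (hchar \<beta> (lam n)) * complex_of_real ((1 - lam n / x) powr k) * hchar \<beta> (lam n) \<omega>))
      = (\<Sum>p | p \<in> ?I \<and> fst p - snd p < x. ?c p * complex_of_real ((1 - (fst p - snd p) / x) powr k))"
      using fmean_sum_reindex[OF f A(1,2), where x = x and F = "\<lambda>y. complex_of_real ((1 - y / x) powr k)
          * hchar \<beta> y \<omega> / of_nat (card A)", symmetric]
      by (simp add: c_def mult_ac)
    also have "cmod \<dots> \<le> 16 / (k * riesz_const k) * (2 * a)"
    proof (rule riesz_mean_le)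
      show "(\<integral>\<^sup>+t. ennreal (cmod (\<Sum>p\<in>?I. ?c p * exp (- (\<i> * complex_of_real (fst p - snd p) * complex_of_real t))))
          * indicator {0..<r} t \<partial>lborel) \<le> ennreal (2 * a * r)" if "0 < r" for r
        unfolding \<phi>_eq using avg[of 1 \<omega> r] E1(3)[of \<omega> r] that \<omega> by simp
      show "(\<integral>\<^sup>+t. ennreal (cmod (\<Sum>p\<in>?I. ?c p * exp (- (\<i> * complex_of_real (fst p - snd p) * complex_of_real (- t)))))
          * indicator {0..<r} t \<partial>lborel) \<le> ennreal (2 * a * r)" if "0 < r" for r
        unfolding \<phi>_eq using avg[of "-1" \<omega> r] E2(3)[of \<omega> r] that \<omega> by simp
    qed (use A x k \<open>0 < a\<close> in auto)
    also have "\<dots> = riesz_bound * a" by (simp add: riesz_bound_def)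
    finally show "cmod (\<Sum>n | lam n < x.
        of_nat (card (A \<inter> (+) (lam n) ` A)) / of_nat (card A) *
        (fourier_coeff m f (hchar \<beta> (lam n)) * complex_of_real ((1 - lam n / x) powr k) * hchar \<beta> (lam n) \<omega>))
      \<le> riesz_bound * a" .
  qed (use E1 E2 in auto)
qed

text \<open>Folner sets adapted to the first J frequencies with error 1/(J+1) make each multiplier
  tend to 1. If \<open>R f\<close> is large at a point, some single Riesz sum is large there, hence
  so are its approximations for all large J, and the point lies in all late exceptional
  sets.\<close>

lemma riesz_max_weak_type:
  assumes f: "f \<in> H1" and "0 < a"
  shows "emeasure m {\<omega>. ennreal (riesz_bound * a) < R f \<omega>}
    \<le> ennreal (2 / a) * (\<integral>\<^sup>+v. ennreal (cmod (f v) - a) \<partial>m)"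
proof -
  let ?r = "\<lambda>A n. of_nat (card (A \<inter> (+) (lam n) ` A)) / of_nat (card A)"
  have "\<exists>A. finite A \<and> A \<noteq> {} \<and> A \<subseteq> freqs \<and>
      (\<forall>n<J. (1 - 1 / real (Suc J)) * real (card A) \<le> real (card (A \<inter> (+) (lam n) ` A)))" for J
    by (rule folner_reals) (auto intro: freqs_0 freqs_add lam_freqs)
  then obtain A where A: "finite (A J)" "A J \<noteq> {}" "A J \<subseteq> freqs"
    and Af: "\<And>n. n < J \<Longrightarrow> (1 - 1 / real (Suc J)) * real (card (A J)) \<le> real (card (A J \<inter> (+) (lam n) ` A J))"
    for J by metis
  have lim: "(\<lambda>J. ?r (A J) n :: real) \<longlonglongrightarrow> 1" for n
  proof (rule tendsto_sandwich)
    show "(\<lambda>J. 1 - 1 / real (Suc J)) \<longlonglongrightarrow> 1"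
      by real_asymp
    have pos: "0 < card (A J)" for J using A[of J] by (simp add: card_gt_0_iff)
    then show "eventually (\<lambda>J. 1 - 1 / real (Suc J) \<le> ?r (A J) n) sequentially"
      using Af by (intro eventually_sequentiallyI[of "Suc n"]) (auto simp: pos_le_divide_eq)
    show "eventually (\<lambda>J. ?r (A J) n \<le> (1::real)) sequentially"
      using A pos by (intro always_eventually allI) (auto simp: divide_le_eq_1_pos intro!: card_mono)
  qed auto
  have limc: "(\<lambda>J. ?r (A J) n :: complex) \<longlonglongrightarrow> 1" for n
    using tendsto_of_real[OF lim[of n], where 'a = complex] by simp
  define P where "P J E \<longleftrightarrow> emeasure m E \<le> ennreal (2 / a) * (\<integral>\<^sup>+v. ennreal (cmod (f v) - a) \<partial>m) \<and>
    (\<forall>\<omega>. \<omega> \<notin> E \<longrightarrow> (\<forall>x>0. cmod (\<Sum>n | lam n < x. ?r (A J) n *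
        (fourier_coeff m f (hchar \<beta> (lam n)) * complex_of_real ((1 - lam n / x) powr k) * hchar \<beta> (lam n) \<omega>))
      \<le> riesz_bound * a))" for J E
  have "\<exists>E\<in>sets m. P J E" for J
    unfolding P_def by (rule fmean_weak_type[OF f A(3,1,2) \<open>0 < a\<close>])
  then obtain E where E: "\<And>J. E J \<in> sets m" and PE: "\<And>J. P J (E J)" by metis
  \<comment> \<open>The union of the \<open>G N\<close> is the lower limit of the sets
    \<open>E J\<close>; it inherits their common bound by continuity from below.\<close>
  define G where "G N = (\<Inter>J\<in>{N..}. E J)" for N :: nat
  have G: "G N \<in> sets m" for N
    unfolding G_def using E by (intro sets.countable_INT') auto
  have "{\<omega>. ennreal (riesz_bound * a) < R f \<omega>} \<subseteq> (\<Union>N. G N)"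
  proof
    fix \<omega> assume "\<omega> \<in> {\<omega>. ennreal (riesz_bound * a) < R f \<omega>}"
    then obtain x where x: "0 < x" "riesz_bound * a < cmod (riesz_sum f x \<omega>)"
      using riesz_bound_pos \<open>0 < a\<close> by (auto simp: R_eq less_SUP_iff ennreal_less_iff)
    have "(\<lambda>J. cmod (\<Sum>n | lam n < x. ?r (A J) n *
        (fourier_coeff m f (hchar \<beta> (lam n)) * complex_of_real ((1 - lam n / x) powr k) * hchar \<beta> (lam n) \<omega>)))
      \<longlonglongrightarrow> cmod (\<Sum>n | lam n < x. 1 *
        (fourier_coeff m f (hchar \<beta> (lam n)) * complex_of_real ((1 - lam n / x) powr k) * hchar \<beta> (lam n) \<omega>))"
      by (intro tendsto_intros limc)
    then have "eventually (\<lambda>J. riesz_bound * a < cmod (\<Sum>n | lam n < x. ?r (A J) n *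
        (fourier_coeff m f (hchar \<beta> (lam n)) * complex_of_real ((1 - lam n / x) powr k) * hchar \<beta> (lam n) \<omega>)))
      sequentially"
      using x(2) by (intro order_tendstoD(1)) (auto simp: riesz_sum_def)
    then obtain N where "\<And>J. N \<le> J \<Longrightarrow> \<omega> \<in> E J"
      using PE x(1) unfolding eventually_sequentially P_def by (meson not_le)
    then show "\<omega> \<in> (\<Union>N. G N)" by (auto simp: G_def)
  qed
  then have "emeasure m {\<omega>. ennreal (riesz_bound * a) < R f \<omega>} \<le> emeasure m (\<Union>N. G N)"
    using G by (intro emeasure_mono) auto
  also have "\<dots> = (SUP N. emeasure m (G N))"
    using G by (intro SUP_emeasure_incseq[symmetric]) (auto simp: incseq_def G_def)
  also have "\<dots> \<le> ennreal (2 / a) * (\<integral>\<^sup>+v. ennreal (cmod (f v) - a) \<partial>m)"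
  proof (rule SUP_least)
    fix N
    have "emeasure m (G N) \<le> emeasure m (E N)"
      using E[of N] by (intro emeasure_mono) (auto simp: G_def)
    also have "\<dots> \<le> ennreal (2 / a) * (\<integral>\<^sup>+v. ennreal (cmod (f v) - a) \<partial>m)"
      using PE[of N] by (simp add: P_def)
    finally show "emeasure m (G N) \<le> ennreal (2 / a) * (\<integral>\<^sup>+v. ennreal (cmod (f v) - a) \<partial>m)" .
  qed
  finally show ?thesis .
qed

end

section \<open>Interpolation and the theorem\<close>

text \<open>The substitution t = e^(-x) in the layer-cake formula, where a^q is the integral of q
  t^(q-1) over 0 < t < a.\<close>

lemma nn_integral_exp_layer:
  fixes a q :: real
  assumes "0 \<le> a" "0 < q"
  shows "(\<integral>\<^sup>+x. ennreal (q * exp (- q * x)) * indicator {x. exp (- x) < a} x \<partial>lborel) = ennreal (a powr q)"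
proof (cases "a = 0")
  case True
  then show ?thesis using assms by (simp add: not_less)
next
  case False
  then have a: "0 < a" using assms by simp
  have "exp (- x) < a \<longleftrightarrow> - ln a < x" for x
    using a by (metis exp_less_cancel_iff exp_ln minus_less_iff)
  then have "(\<integral>\<^sup>+x. ennreal (q * exp (- q * x)) * indicator {x. exp (- x) < a} x \<partial>lborel)
      = (\<integral>\<^sup>+x. ennreal (q * exp (- q * x)) * indicator {- ln a..} x \<partial>lborel)"
    using AE_lborel_singleton[of "- ln a"]
    by (intro nn_integral_cong_AE) (auto simp: indicator_def elim!: eventually_mono)
  also have "\<dots> = ennreal (a powr q)"
    using a by (subst nn_integral_exp_atLeast[OF assms(2)]) (simp add: powr_def)
  finally show ?thesis .
qed

text \<open>The layer-cake levels are parametrized as \<open>e\<^bsup>-x\<^esup>\<close>, so that no integrand is singular for \<open>q < 2\<close>.\<close>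

lemma nn_integral_powr_le_of_weak_type:
  fixes h F :: "'a \<Rightarrow> real"
  assumes "sigma_finite_measure M" and q: "1 < q" and "0 < c"
    and [measurable]: "h \<in> borel_measurable M" "F \<in> borel_measurable M"
    and nonneg: "\<And>\<omega>. 0 \<le> h \<omega>" "\<And>\<omega>. 0 \<le> F \<omega>"
    and weak: "\<And>a. 0 < a \<Longrightarrow>
      emeasure M {\<omega> \<in> space M. c * a < h \<omega>} \<le> ennreal (2 / a) * (\<integral>\<^sup>+\<omega>. ennreal (F \<omega> - a) \<partial>M)"
  shows "(\<integral>\<^sup>+\<omega>. ennreal (h \<omega> powr q) \<partial>M)
    \<le> ennreal (c powr q * (2 * q / (q - 1))) * (\<integral>\<^sup>+\<omega>. ennreal (F \<omega> powr q) \<partial>M)"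
proof -
  interpret sigma_finite_measure M by fact
  interpret pair_sigma_finite M lborel ..
  let ?w = "\<lambda>x. ennreal (q * exp (- q * x))"
  have "(\<integral>\<^sup>+\<omega>. ennreal (h \<omega> powr q) \<partial>M) = (\<integral>\<^sup>+\<omega>. ennreal (c powr q) * ennreal ((h \<omega> / c) powr q) \<partial>M)"
    using \<open>0 < c\<close> nonneg by (intro nn_integral_cong) (simp add: powr_divide flip: ennreal_mult)
  also have "\<dots> = ennreal (c powr q) * (\<integral>\<^sup>+\<omega>. ennreal ((h \<omega> / c) powr q) \<partial>M)"
    by (rule nn_integral_cmult) measurable
  finally have scale: "(\<integral>\<^sup>+\<omega>. ennreal (h \<omega> powr q) \<partial>M)
      = ennreal (c powr q) * (\<integral>\<^sup>+\<omega>. ennreal ((h \<omega> / c) powr q) \<partial>M)" .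
  have "(\<integral>\<^sup>+\<omega>. ennreal ((h \<omega> / c) powr q) \<partial>M)
      = (\<integral>\<^sup>+\<omega>. (\<integral>\<^sup>+x. ?w x * indicator {x. exp (- x) < h \<omega> / c} x \<partial>lborel) \<partial>M)"
    using q \<open>0 < c\<close> nonneg by (intro nn_integral_cong nn_integral_exp_layer[symmetric]) auto
  also have "\<dots> = (\<integral>\<^sup>+x. (\<integral>\<^sup>+\<omega>. ?w x * indicator {x. exp (- x) < h \<omega> / c} x \<partial>M) \<partial>lborel)"
    by (rule Fubini'[symmetric]) measurable
  also have "\<dots> \<le> (\<integral>\<^sup>+x. (\<integral>\<^sup>+\<omega>. ennreal (2 * q / (q - 1)) * (ennreal (F \<omega>) *
      (ennreal ((q - 1) * exp (- (q - 1) * x)) * indicator {x. exp (- x) < F \<omega>} x)) \<partial>M) \<partial>lborel)"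
  proof (rule nn_integral_mono)
    fix x
    have "(\<integral>\<^sup>+\<omega>. ?w x * indicator {x. exp (- x) < h \<omega> / c} x \<partial>M)
        = (\<integral>\<^sup>+\<omega>. ?w x * indicator {\<omega> \<in> space M. c * exp (- x) < h \<omega>} \<omega> \<partial>M)"
      using \<open>0 < c\<close> by (intro nn_integral_cong) (auto simp: indicator_def field_simps)
    also have "\<dots> = ?w x * emeasure M {\<omega> \<in> space M. c * exp (- x) < h \<omega>}"
      by (rule nn_integral_cmult_indicator) measurable
    also have "\<dots> \<le> ?w x * (ennreal (2 / exp (- x)) * (\<integral>\<^sup>+\<omega>. ennreal (F \<omega> - exp (- x)) \<partial>M))"
      by (intro mult_left_mono weak) auto
    \<comment> \<open>The excess is at most \<open>F\<close> where \<open>F\<close> is above the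
      level. One power of \<open>F\<close> is thereby spent, so the remaining layer integral has
      exponent \<open>q - 1\<close>, and q/(q-1) is the ratio of the two normalizations.\<close>
    also have "\<dots> \<le> ?w x * (ennreal (2 / exp (- x)) * (\<integral>\<^sup>+\<omega>. ennreal (F \<omega>) * indicator {x. exp (- x) < F \<omega>} x \<partial>M))"
      by (intro mult_left_mono nn_integral_mono) (auto simp: indicator_def ennreal_neg intro!: ennreal_leI)
    also have "\<dots> = ennreal (2 * q / (q - 1)) * ennreal ((q - 1) * exp (- (q - 1) * x))
        * (\<integral>\<^sup>+\<omega>. ennreal (F \<omega>) * indicator {x. exp (- x) < F \<omega>} x \<partial>M)"
    proof -
      have "exp (- (q - 1) * x) = exp (- q * x) * exp x"
        by (simp add: algebra_simps flip: exp_add)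
      then have "q * exp (- q * x) * (2 / exp (- x)) = 2 * q / (q - 1) * ((q - 1) * exp (- (q - 1) * x))"
        using q by (simp add: exp_minus field_simps)
      then have "?w x * ennreal (2 / exp (- x)) = ennreal (2 * q / (q - 1)) * ennreal ((q - 1) * exp (- (q - 1) * x))"
        using q by (simp flip: ennreal_mult)
      then show ?thesis by (subst mult.assoc[symmetric]) (simp only:)
    qed
    also have "\<dots> = (\<integral>\<^sup>+\<omega>. ennreal (2 * q / (q - 1)) * (ennreal (F \<omega>) *
      (ennreal ((q - 1) * exp (- (q - 1) * x)) * indicator {x. exp (- x) < F \<omega>} x)) \<partial>M)"
    proof -
      have ac: "a * (b * (c * d)) = a * c * (b * d)" for a b c d :: ennreal
        by (simp add: mult_ac)
      show ?thesis
        by (subst nn_integral_cmult[symmetric]) (measurable, intro nn_integral_cong ac[symmetric])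
    qed
    finally show "(\<integral>\<^sup>+\<omega>. ?w x * indicator {x. exp (- x) < h \<omega> / c} x \<partial>M)
        \<le> (\<integral>\<^sup>+\<omega>. ennreal (2 * q / (q - 1)) * (ennreal (F \<omega>) *
      (ennreal ((q - 1) * exp (- (q - 1) * x)) * indicator {x. exp (- x) < F \<omega>} x)) \<partial>M)" .
  qed
  also have "\<dots> = (\<integral>\<^sup>+\<omega>. (\<integral>\<^sup>+x. ennreal (2 * q / (q - 1)) * (ennreal (F \<omega>) *
      (ennreal ((q - 1) * exp (- (q - 1) * x)) * indicator {x. exp (- x) < F \<omega>} x)) \<partial>lborel) \<partial>M)"
    by (rule Fubini') measurable
  also have "\<dots> = (\<integral>\<^sup>+\<omega>. ennreal (2 * q / (q - 1)) * ennreal (F \<omega> powr q) \<partial>M)"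
  proof (intro nn_integral_cong)
    fix \<omega>
    have "(\<integral>\<^sup>+x. ennreal (2 * q / (q - 1)) * (ennreal (F \<omega>) *
        (ennreal ((q - 1) * exp (- (q - 1) * x)) * indicator {x. exp (- x) < F \<omega>} x)) \<partial>lborel)
      = ennreal (2 * q / (q - 1)) * (ennreal (F \<omega>) * ennreal (F \<omega> powr (q - 1)))"
      using q nonneg by (subst nn_integral_exp_layer[symmetric]) (auto simp: nn_integral_cmult)
    also have "ennreal (F \<omega>) * ennreal (F \<omega> powr (q - 1)) = ennreal (F \<omega> powr q)"
      using nonneg(2)[of \<omega>] powr_mult_base[of "F \<omega>" "q - 1"] by (simp flip: ennreal_mult)
    finally show "(\<integral>\<^sup>+x. ennreal (2 * q / (q - 1)) * (ennreal (F \<omega>) *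
        (ennreal ((q - 1) * exp (- (q - 1) * x)) * indicator {x. exp (- x) < F \<omega>} x)) \<partial>lborel)
      = ennreal (2 * q / (q - 1)) * ennreal (F \<omega> powr q)" .
  qed
  also have "\<dots> = ennreal (2 * q / (q - 1)) * (\<integral>\<^sup>+\<omega>. ennreal (F \<omega> powr q) \<partial>M)"
    by (rule nn_integral_cmult) measurable
  finally have "(\<integral>\<^sup>+\<omega>. ennreal ((h \<omega> / c) powr q) \<partial>M)
      \<le> ennreal (2 * q / (q - 1)) * (\<integral>\<^sup>+\<omega>. ennreal (F \<omega> powr q) \<partial>M)" .
  moreover have "ennreal (c powr q * (2 * q / (q - 1))) = ennreal (c powr q) * ennreal (2 * q / (q - 1))"
    using q by (intro ennreal_mult) auto
  ultimately show ?thesis unfolding scale by (simp only: mult.assoc) (rule mult_left_mono, simp_all)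
qed

lemma Lp_norm_1: "Lp_norm M 1 f = (\<integral>\<^sup>+\<omega>. ennreal (cmod (f \<omega>)) \<partial>M)"
  by (simp add: Lp_norm_def Let_def ennreal_enn2real_if)

lemma Lp_norm_mono_powr:
  assumes "p \<noteq> \<infinity>" "0 < enn2real p" "0 \<le> K"
    and le: "(\<integral>\<^sup>+\<omega>. ennreal (cmod (g \<omega>) powr enn2real p) \<partial>M)
      \<le> ennreal K * (\<integral>\<^sup>+\<omega>. ennreal (cmod (f \<omega>) powr enn2real p) \<partial>M)"
    and fin: "Lp_norm M p f < \<infinity>"
  shows "Lp_norm M p g \<le> ennreal (K powr (1 / enn2real p)) * Lp_norm M p f"
proof -
  define q where "q = enn2real p"
  let ?I = "\<lambda>f. \<integral>\<^sup>+\<omega>. ennreal (cmod (f \<omega>) powr q) \<partial>M"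
  have f: "?I f < \<infinity>" using fin assms(1) by (auto simp: Lp_norm_def Let_def q_def top.not_eq_extremum split: if_splits)
  have lt: "ennreal K * ?I f < \<infinity>" using f by (simp add: ennreal_mult_less_top)
  then have g: "?I g < \<infinity>" using le by (auto simp: q_def)
  have "enn2real (?I g) \<le> K * enn2real (?I f)"
    using enn2real_mono[OF le[folded q_def]] lt assms(3) by (simp add: enn2real_mult)
  then have "enn2real (?I g) powr (1 / q) \<le> (K * enn2real (?I f)) powr (1 / q)"
    using assms(2) by (intro powr_mono2) (auto simp: q_def)
  also have "\<dots> = K powr (1 / q) * enn2real (?I f) powr (1 / q)"
    using assms(3) by (simp add: powr_mult)
  finally have "ennreal (enn2real (?I g) powr (1 / q)) \<le> ennreal (K powr (1 / q)) * ennreal (enn2real (?I f) powr (1 / q))"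
    by (simp add: ennreal_leI flip: ennreal_mult)
  moreover have "Lp_norm M p h = ennreal (enn2real (?I h) powr (1 / q))" if "?I h < \<infinity>" for h
    unfolding Lp_norm_def q_def[symmetric] Let_def using that assms(1) by simp
  ultimately show ?thesis using f g by (simp only: q_def)
qed

section \<open>Sublinearity and the norm bounds of the maximal operator\<close>

context dirichlet_riesz
begin

lemma Hp_subset_H1:
  assumes "1 \<le> p"
  shows "Hp_space m \<beta> lam p \<subseteq> H1"
proof
  fix f assume "f \<in> Hp_space m \<beta> lam p"
  then have f [measurable]: "f \<in> borel_measurable m" and fin: "Lp_norm m p f < \<infinity>"
    and sp: "\<forall>\<gamma>. character \<gamma> \<and> fourier_coeff m f \<gamma> \<noteq> 0 \<longrightarrow> (\<exists>n. \<gamma> = hchar \<beta> (lam n))"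
    by (auto simp: Hp_space_def Lp_space_def)
  have "integrable m f"
  proof (cases "p = \<infinity>")
    case True
    define S where "S = esssup m (\<lambda>\<omega>. ennreal (cmod (f \<omega>)))"
    have S: "S < \<infinity>" using fin True by (simp add: Lp_norm_def S_def)
    have "AE \<omega> in m. ennreal (cmod (f \<omega>)) \<le> S" unfolding S_def by (rule esssup_AE)
    then have "AE \<omega> in m. cmod (f \<omega>) \<le> enn2real S"
    proof eventually_elim
      case (elim \<omega>)
      then show ?case using enn2real_mono[OF elim] S by simp
    qed
    then show ?thesis by (intro integrable_const_bound) auto
  next
    case False
    define q where "q = enn2real p"
    have q: "1 \<le> q" using enn2real_mono[OF assms] False by (simp add: q_def top.not_eq_extremum)
    have "(\<integral>\<^sup>+\<omega>. ennreal (cmod (f \<omega>) powr q) \<partial>m) < \<infinity>"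
      using fin False by (auto simp: Lp_norm_def Let_def q_def top.not_eq_extremum split: if_splits)
    then have "integrable m (\<lambda>\<omega>. cmod (f \<omega>) powr q)"
      by (simp add: integrable_iff_bounded)
    then have "integrable m (\<lambda>\<omega>. 1 + cmod (f \<omega>) powr q)" by simp
    then show ?thesis
    proof (rule Bochner_Integration.integrable_bound)
      have "cmod z \<le> 1 + cmod z powr q" for z :: complex
      proof (cases "cmod z \<le> 1")
        case False
        then show ?thesis using powr_mono[OF q, of "cmod z"] by simp
      qed (simp add: add_increasing2)
      then show "AE \<omega> in m. norm (f \<omega>) \<le> norm (1 + cmod (f \<omega>) powr q)"
        by (intro AE_I2) (simp add: add_nonneg_nonneg)
    qed simp
  qed
  then show "f \<in> H1" using sp by (simp add: H1_def)
qed

lemma coeff_integrable: "integrable m f \<Longrightarrow> integrable m (\<lambda>v. f v * cnj (hchar \<beta> (lam n) v))"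
  using hchar_measurable[OF lam_freqs]
  by (auto intro!: Bochner_Integration.integrable_bound[of m f] simp: norm_mult norm_hchar lam_freqs)

text \<open>\<open>R f\<close> depends on \<open>f\<close> only through Fourier coefficients, so the
  equality holds at every point.\<close>

lemma R_cong_AE:
  assumes "f \<in> H1" "g \<in> H1" "AE \<omega> in m. f \<omega> = g \<omega>"
  shows "R f \<omega> = R g \<omega>"
proof -
  have "fourier_coeff m f (hchar \<beta> (lam n)) = fourier_coeff m g (hchar \<beta> (lam n))" for n
    unfolding fourier_coeff_def using assms coeff_integrable[of _ n]
    by (intro integral_cong_AE) (auto simp: H1_def elim!: eventually_mono)
  then show ?thesis by (simp add: riesz_max_def)
qed

lemma R_add_le:
  assumes "f \<in> H1" "g \<in> H1"
  shows "R (\<lambda>v. f v + g v) \<omega> \<le> R f \<omega> + R g \<omega>"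
  unfolding R_eq[of "\<lambda>v. f v + g v"]
proof (rule SUP_least)
  fix x :: real assume x: "x \<in> {0<..}"
  have "fourier_coeff m (\<lambda>v. f v + g v) (hchar \<beta> (lam n))
      = fourier_coeff m f (hchar \<beta> (lam n)) + fourier_coeff m g (hchar \<beta> (lam n))" for n
    unfolding fourier_coeff_def using assms coeff_integrable[of _ n]
    by (simp add: distrib_right H1_def)
  then have "riesz_sum (\<lambda>v. f v + g v) x \<omega> = riesz_sum f x \<omega> + riesz_sum g x \<omega>"
    by (simp add: riesz_sum_def distrib_right sum.distrib)
  then have "ennreal (cmod (riesz_sum (\<lambda>v. f v + g v) x \<omega>))
      \<le> ennreal (cmod (riesz_sum f x \<omega>)) + ennreal (cmod (riesz_sum g x \<omega>))"
    by (simp add: norm_triangle_ineq ennreal_leI flip: ennreal_plus)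
  also have "\<dots> \<le> R f \<omega> + R g \<omega>"
    unfolding R_eq using x by (intro add_mono SUP_upper)
  finally show "ennreal (cmod (riesz_sum (\<lambda>v. f v + g v) x \<omega>)) \<le> R f \<omega> + R g \<omega>" .
qed

lemma R_mult: "R (\<lambda>v. c * f v) \<omega> = ennreal (cmod c) * R f \<omega>"
proof -
  have "riesz_sum (\<lambda>v. c * f v) x \<omega> = c * riesz_sum f x \<omega>" for x
    by (simp add: riesz_sum_def fourier_coeff_def sum_distrib_left mult.assoc)
  then show ?thesis
    by (simp add: R_eq norm_mult ennreal_mult SUP_mult_left_ennreal)
qed

lemma R_finite_AE:
  assumes "f \<in> H1"
  shows "AE \<omega> in m. R f \<omega> < \<infinity>"
proof -
  define I where "I = (\<integral>\<^sup>+v. ennreal (cmod (f v)) \<partial>m)"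
  have I: "I < \<infinity>" using assms by (simp add: H1_def I_def integrable_iff_bounded)
  have "emeasure m {\<omega>. R f \<omega> = \<infinity>} \<le> 0 + ennreal e" if "0 < e" for e
  proof -
    \<comment> \<open>Chosen so that 2/a times \<open>I\<close> is below \<open>e\<close>; the
      summand 1 keeps \<open>a\<close> positive when \<open>I = 0\<close>.\<close>
    define a where "a = 2 * (enn2real I + 1) / e"
    have a: "0 < a" using that by (simp add: a_def add_nonneg_pos)
    have "e * a = 2 * (enn2real I + 1)" using that by (simp add: a_def)
    then have ae: "2 / a * enn2real I \<le> e" using a by (simp add: pos_divide_le_eq)
    have "emeasure m {\<omega>. R f \<omega> = \<infinity>} \<le> emeasure m {\<omega>. ennreal (riesz_bound * a) < R f \<omega>}"
      by (intro emeasure_mono R_level_measurable) auto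
    also have "\<dots> \<le> ennreal (2 / a) * (\<integral>\<^sup>+v. ennreal (cmod (f v) - a) \<partial>m)"
      by (rule riesz_max_weak_type[OF assms a])
    also have "\<dots> \<le> ennreal (2 / a) * I"
      unfolding I_def using a by (intro mult_left_mono nn_integral_mono ennreal_leI) auto
    also have "I = ennreal (enn2real I)" using I by simp
    also have "ennreal (2 / a) * \<dots> = ennreal (2 / a * enn2real I)"
      using a by (simp flip: ennreal_mult)
    also have "\<dots> \<le> ennreal e"
      by (intro ennreal_leI ae)
    finally show ?thesis by simp
  qed
  then have "emeasure m {\<omega>. R f \<omega> = \<infinity>} \<le> 0"
    by (rule ennreal_le_epsilon)
  moreover have "{\<omega> \<in> space m. R f \<omega> = \<infinity>} \<in> sets m" by measurable
  ultimately show ?thesis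
    by (intro AE_I[where N = "{\<omega>. R f \<omega> = \<infinity>}"]) (auto simp flip: less_top)
qed

lemma complex_version_measurable [measurable]: "complex_version (R f) \<in> borel_measurable m"
  unfolding complex_version_def[abs_def] by measurable

text \<open>Replacing the value \<infinity> by 0 can only shrink the superlevel sets at nonnegative
  levels.\<close>

lemma complex_version_weak_type:
  assumes "f \<in> H1" "0 < a"
  shows "emeasure m {\<omega> \<in> space m. riesz_bound * a < cmod (complex_version (R f) \<omega>)}
    \<le> ennreal (2 / a) * (\<integral>\<^sup>+v. ennreal (cmod (f v) - a) \<partial>m)"
proof -
  have "ennreal y < r" if "y < enn2real r" "0 \<le> y" for y r
    using that by (cases r) (auto simp: ennreal_less_iff)
  then have "{\<omega> \<in> space m. riesz_bound * a < cmod (complex_version (R f) \<omega>)} \<subseteq> {\<omega>. ennreal (riesz_bound * a) < R f \<omega>}"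
    using assms(2) riesz_bound_pos by (auto simp: complex_version_def)
  then have "emeasure m {\<omega> \<in> space m. riesz_bound * a < cmod (complex_version (R f) \<omega>)}
      \<le> emeasure m {\<omega>. ennreal (riesz_bound * a) < R f \<omega>}"
    by (intro emeasure_mono R_level_measurable)
  also note riesz_max_weak_type[OF assms]
  finally show ?thesis .
qed

lemma bounded_sublinear_operator_R:
  assumes "X \<subseteq> H1" "0 \<le> C"
    and "\<And>f. f \<in> X \<Longrightarrow> complex_version (R f) \<in> Y"
    and "\<And>f. f \<in> X \<Longrightarrow> norm_Y (complex_version (R f)) \<le> ennreal C * norm_X f"
  shows "bounded_sublinear_operator m X norm_X Y norm_Y R"
  unfolding bounded_sublinear_operator_def
proof (intro conjI ballI allI impI)
  show "\<exists>C::real. 0 \<le> C \<and> (\<forall>f\<in>X. norm_Y (complex_version (R f)) \<le> ennreal C * norm_X f)"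
    using assms by blast
qed (use assms(1,3) in \<open>auto intro!: AE_I2 R_cong_AE R_add_le R_mult R_finite_AE[unfolded infinity_ennreal_def]\<close>)

lemma weak_L1_norm_R_le:
  assumes f: "f \<in> H1"
  shows "weak_L1_norm m (complex_version (R f)) \<le> ennreal (2 * riesz_bound) * Lp_norm m 1 f"
proof (rule ennreal_le_epsilon)
  fix e :: real assume "0 < e"
  define I where "I = (\<integral>\<^sup>+v. ennreal (cmod (f v)) \<partial>m)"
  have "I < \<infinity>" using f by (simp add: H1_def I_def integrable_iff_bounded)
  then have I: "I = ennreal (enn2real I)" by simp
  \<comment> \<open>The infimum in \<open>weak_L1_norm\<close> admits only positive constants;
    \<open>e\<close> keeps \<open>C\<close> positive when \<open>f\<close> vanishes almost
    everywhere.\<close>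
  define C where "C = 2 * riesz_bound * enn2real I + e"
  have C: "0 < C" using \<open>0 < e\<close> riesz_bound_pos by (simp add: C_def add_nonneg_pos)
  have "emeasure m {\<omega> \<in> space m. \<alpha> < cmod (complex_version (R f) \<omega>)} \<le> ennreal (C / \<alpha>)"
    if "0 < \<alpha>" for \<alpha>
  proof -
    define a where "a = \<alpha> / riesz_bound"
    have a: "0 < a" using that riesz_bound_pos by (simp add: a_def)
    have "emeasure m {\<omega> \<in> space m. \<alpha> < cmod (complex_version (R f) \<omega>)}
        \<le> ennreal (2 / a) * (\<integral>\<^sup>+v. ennreal (cmod (f v) - a) \<partial>m)"
      using complex_version_weak_type[OF f a] riesz_bound_pos by (simp add: a_def)
    also have "\<dots> \<le> ennreal (2 / a) * I"
      unfolding I_def using a by (intro mult_left_mono nn_integral_mono ennreal_leI) auto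
    also have "\<dots> = ennreal (2 / a * enn2real I)"
      using a by (subst I) (simp flip: ennreal_mult)
    also have "\<dots> \<le> ennreal (C / \<alpha>)"
      using that \<open>0 < e\<close> riesz_bound_pos by (intro ennreal_leI) (simp add: a_def C_def field_simps)
    finally show ?thesis .
  qed
  then have "weak_L1_norm m (complex_version (R f)) \<le> ennreal C"
    unfolding weak_L1_norm_def using C by (intro INF_lower) auto
  also have "\<dots> = ennreal (2 * riesz_bound) * Lp_norm m 1 f + ennreal e"
    unfolding Lp_norm_1 I_def[symmetric] using \<open>0 < e\<close> riesz_bound_pos
    by (subst I) (simp add: C_def flip: ennreal_mult ennreal_plus)
  finally show "weak_L1_norm m (complex_version (R f)) \<le> ennreal (2 * riesz_bound) * Lp_norm m 1 f + ennreal e" .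
qed

lemma Linfty_norm_R_le:
  assumes f: "f \<in> H1" and fin: "Lp_norm m \<infinity> f < \<infinity>"
  shows "Lp_norm m \<infinity> (complex_version (R f)) \<le> ennreal riesz_bound * Lp_norm m \<infinity> f"
proof (rule ennreal_le_epsilon)
  fix e :: real assume "0 < e"
  have [measurable]: "f \<in> borel_measurable m" using f by (auto simp: H1_def)
  define S where "S = Lp_norm m \<infinity> f"
  have S: "S = ennreal (enn2real S)" using fin by (simp add: S_def)
  \<comment> \<open>At a level above the essential supremum the excess integrates to 0, so the
    weak-type bound yields a null set. The extra term makes the level positive and costs
    \<open>e\<close> after multiplication by \<open>riesz_bound\<close>.\<close>
  define a where "a = enn2real S + e / riesz_bound"
  have a: "0 < a" using \<open>0 < e\<close> riesz_bound_pos by (simp add: a_def add_nonneg_pos)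
  have "AE v in m. ennreal (cmod (f v)) \<le> S"
    unfolding S_def Lp_norm_def by (simp add: esssup_AE)
  then have "AE v in m. ennreal (cmod (f v) - a) = 0"
  proof eventually_elim
    case (elim v)
    then have "cmod (f v) \<le> enn2real S" by (subst (asm) S) (simp add: ennreal_le_iff)
    then show ?case using \<open>0 < e\<close> riesz_bound_pos by (simp add: ennreal_eq_0_iff a_def add_increasing2)
  qed
  then have "(\<integral>\<^sup>+v. ennreal (cmod (f v) - a) \<partial>m) = 0"
    by (subst nn_integral_0_iff_AE) auto
  then have "emeasure m {\<omega> \<in> space m. riesz_bound * a < cmod (complex_version (R f) \<omega>)} \<le> 0"
    using complex_version_weak_type[OF f a] by simp
  moreover have "{\<omega> \<in> space m. riesz_bound * a < cmod (complex_version (R f) \<omega>)} \<in> sets m" by measurable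
  ultimately have "AE \<omega> in m. ennreal (cmod (complex_version (R f) \<omega>)) \<le> ennreal (riesz_bound * a)"
    using a riesz_bound_pos
    by (intro AE_I[where N = "{\<omega> \<in> space m. riesz_bound * a < cmod (complex_version (R f) \<omega>)}"])
      (auto simp: not_le ennreal_less_iff)
  then have "esssup m (\<lambda>\<omega>. ennreal (cmod (complex_version (R f) \<omega>))) \<le> ennreal (riesz_bound * a)"
    by (intro esssup_I) measurable
  also have "riesz_bound * a = riesz_bound * enn2real S + e"
    using riesz_bound_pos by (simp add: a_def field_simps)
  also have "ennreal \<dots> = ennreal riesz_bound * S + ennreal e"
    using \<open>0 < e\<close> riesz_bound_pos by (subst S) (simp flip: ennreal_mult ennreal_plus)
  finally show "Lp_norm m \<infinity> (complex_version (R f)) \<le> ennreal riesz_bound * Lp_norm m \<infinity> f + ennreal e"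
    by (simp add: Lp_norm_def S_def)
qed

lemma Lp_norm_R_le:
  assumes f: "f \<in> H1" and fin: "Lp_norm m p f < \<infinity>" and p: "1 < p" "p \<noteq> \<infinity>"
  shows "Lp_norm m p (complex_version (R f))
    \<le> ennreal ((riesz_bound powr enn2real p * (2 * enn2real p / (enn2real p - 1))) powr (1 / enn2real p))
      * Lp_norm m p f"
proof -
  define q where "q = enn2real p"
  have q: "1 < q" using p by (cases p) (auto simp: q_def)
  have [measurable]: "f \<in> borel_measurable m" using f by (auto simp: H1_def)
  have "(\<integral>\<^sup>+\<omega>. ennreal (cmod (complex_version (R f) \<omega>) powr q) \<partial>m)
    \<le> ennreal (riesz_bound powr q * (2 * q / (q - 1))) * (\<integral>\<^sup>+\<omega>. ennreal (cmod (f \<omega>) powr q) \<partial>m)"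
    by (rule nn_integral_powr_le_of_weak_type[OF _ q riesz_bound_pos])
      (use sigma_finite_measure_axioms complex_version_weak_type[OF f] in auto)
  then show ?thesis
    using p q fin by (intro Lp_norm_mono_powr) (auto simp: q_def)
qed

end

theorem theorem2p1:
  fixes lam :: "nat \<Rightarrow> real" and k :: real
    and \<beta> :: "real \<Rightarrow> 'a::{topological_ab_group_add, t2_space}"
    and m :: "'a measure"
  assumes "frequency lam"
    and "k > 0"
    and "lambda_dirichlet_group lam \<beta>"
    and "normalized_haar_measure m"
  shows "bounded_sublinear_operator m
           (Hp_space m \<beta> lam 1) (Lp_norm m 1) (weak_L1_space m) (weak_L1_norm m)
           (riesz_max m \<beta> lam k) \<and>
         (\<forall>p::ennreal. 1 < p \<longrightarrow> bounded_sublinear_operator m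
           (Hp_space m \<beta> lam p) (Lp_norm m p) (Lp_space m p) (Lp_norm m p)
           (riesz_max m \<beta> lam k))"
proof -
  interpret dirichlet_haar \<beta> m
    using assms by unfold_locales (auto simp: lambda_dirichlet_group_def)
  interpret dirichlet_riesz \<beta> m lam k
    using assms by unfold_locales (auto simp: lambda_dirichlet_group_def freqs_def)
  have fin: "Lp_norm m p f < \<infinity>" if "f \<in> Hp_space m \<beta> lam p" for f p
    using that by (simp add: Hp_space_def Lp_space_def)
  have "bounded_sublinear_operator m (Hp_space m \<beta> lam 1) (Lp_norm m 1) (weak_L1_space m) (weak_L1_norm m) R"
  proof (rule bounded_sublinear_operator_R)
    fix f assume f: "f \<in> Hp_space m \<beta> lam 1"
    then have "f \<in> H1" using Hp_subset_H1[of 1] by auto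
    then show le: "weak_L1_norm m (complex_version (R f)) \<le> ennreal (2 * riesz_bound) * Lp_norm m 1 f"
      by (rule weak_L1_norm_R_le)
    also have "\<dots> < \<infinity>" using fin[OF f] by (simp add: ennreal_mult_less_top)
    finally show "complex_version (R f) \<in> weak_L1_space m" by (simp add: weak_L1_space_def)
  qed (use riesz_bound_pos Hp_subset_H1 in auto)
  moreover have "bounded_sublinear_operator m (Hp_space m \<beta> lam p) (Lp_norm m p) (Lp_space m p) (Lp_norm m p) R"
    if p: "1 < p" for p
  proof -
    obtain C :: real where C: "0 \<le> C" and le:
      "\<And>f. f \<in> Hp_space m \<beta> lam p \<Longrightarrow> Lp_norm m p (complex_version (R f)) \<le> ennreal C * Lp_norm m p f"
    proof (cases "p = \<infinity>")
      case True
      show thesis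
        using Linfty_norm_R_le fin[of _ p] Hp_subset_H1[of p] riesz_bound_pos p True
        by (intro that[of riesz_bound]) (auto intro: less_imp_le)
    next
      case False
      show thesis
        using Lp_norm_R_le[of _ p] fin[of _ p] Hp_subset_H1[of p] p False
        by (intro that[of "(riesz_bound powr enn2real p * (2 * enn2real p / (enn2real p - 1))) powr (1 / enn2real p)"])
          (auto intro: less_imp_le)
    qed
    show ?thesis
    proof (rule bounded_sublinear_operator_R)
      fix f assume f: "f \<in> Hp_space m \<beta> lam p"
      show "Lp_norm m p (complex_version (R f)) \<le> ennreal C * Lp_norm m p f" by (rule le[OF f])
      also have "\<dots> < \<infinity>" using fin[OF f] by (simp add: ennreal_mult_less_top)
      finally show "complex_version (R f) \<in> Lp_space m p" by (simp add: Lp_space_def)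
    qed (use C Hp_subset_H1 p in auto)
  qed
  ultimately show ?thesis by blast
qed

end
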